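(* Let $(V,\langle\cdot,\cdot\rangle)$ be a hermitian vector space, and let $g$ be a Riemannian metric on $V\smallsetminus\{0\}$ of the form $$g=S(r)\,\mathrm{Re}\langle\cdot,\cdot\rangle_{\mathcal V}+T(r)\,\mathrm{Re}\langle\cdot,\cdot\rangle_{\mathcal H},\qquad r=|x|,$$ where $S$ and $T$ are arbitrary smooth and positive functions of $r$. Let $s$ be the scalar curvature of $g$. For a self-adjoint linear operator $A$ on $V$ put $F=F_A:=\langle Ax,x\rangle$. (1) The following are equivalent: (a) $g$ is Kähler. (b) $g$ is an SKR metric. (c) The linear ODE $S=T+(r/2)\,T_r$ holds, where $T_r$ is the derivative of $T(r)$. (d) All linear vector fields $x\mapsto Ax$ (with $A$ self-adjoint) are $g$-gradient with holomorphy potentials given by $$\varphi=\tfrac12\,F\,T+C,\qquad C\ \text{constant}.$$ (2) If $\dim V\ge 3$ while any of the conditions in Part (1) holds, and $g$ satisfies the equation $$\varphi_2=p(s)\,h(\varphi_1)$$ for holomorphy potentials $\varphi_1,\varphi_2$ of linearly independent (self-adjoint) linear vector fields and smooth functions $p$, $h$, then $h$ is constant.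
   Context: A hermitian vector space is a finite-dimensional complex vector space with a hermitian inner product; $\dim V$ is its complex dimension, and $|x|=\langle x,x\rangle^{1/2}$. On $V\smallsetminus\{0\}$, $\mathcal V$ is the distribution in the tangent bundle consisting, at $x\neq0$, of all (complex) multiples of $x$, and $\mathcal H$ is its orthogonal distribution with respect to $\langle\cdot,\cdot\rangle$. $\mathrm{Re}\langle\cdot,\cdot\rangle_{\mathcal V}$ and $\mathrm{Re}\langle\cdot,\cdot\rangle_{\mathcal H}$ denote the restrictions to $\mathcal V$ and $\mathcal H$ of the real part of the hermitian inner product (so $\mathcal V$ and $\mathcal H$ are $g$-orthogonal). "Kähler" is with respect to the standard complex structure $J$ of $V$ (multiplication by $i$), i.e. the form $\omega(\cdot,\cdot)=g(J\cdot,\cdot)$ is closed. A Killing potential on a Kähler manifold is a smooth real function $\tau$ such that $J\nabla\tau$ is a Killing vector field. An SKR metric is a Kähler metric $g$ which admits a Killing potential $\tau$ such that at each point where $d\tau\ne0$, all nonzero vectors orthogonal to the complex span of $\nabla\tau$ are eigenvectors of both the Ricci tensor and the Hessian of $\tau$, considered as operators. A linear vector field $x\mapsto Ax$ with $A$ self-adjoint is called self-adjoint; it is $g$-gradient with holomorphy potential $\varphi$ if its $g$-dual one-form is $d\varphi$, i.e. $g(Ax,\cdot)=d\varphi$.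
   Formalization: The formal theorem assumes dim V ≥ 2: in dimension 1 the distribution H is zero and every such g is Kähler, so (a) does not imply (c), e.g. for S = 1, T = 1 + r² (and the equivalence also fails in dimension 0). *)

theory Defs
  imports "HOL-Analysis.Analysis"
begin

section \<open>Hermitian vector spaces\<close>

text \<open>
  The Euclidean structure of the underlying real space is the real part of the hermitian inner
  product, so that \<open>norm x\<close> is the hermitian norm, and the complex scalar multiplication extends the real
  one. Positive definiteness and the symmetry of the real part come with \<^class>\<open>euclidean_space\<close>.
\<close>

class hermitian_vector_space = euclidean_space +
  fixes scaleC :: "complex \<Rightarrow> 'a \<Rightarrow> 'a"  (infixr \<open>*\<^sub>C\<close> 75)
    and hip :: "'a \<Rightarrow> 'a \<Rightarrow> complex"
  assumes scaleC_add_right: "c *\<^sub>C (x + y) = c *\<^sub>C x + c *\<^sub>C y"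
    and scaleC_add_left: "(c + d) *\<^sub>C x = c *\<^sub>C x + d *\<^sub>C x"
    and scaleC_scaleC: "c *\<^sub>C d *\<^sub>C x = (c * d) *\<^sub>C x"
    and scaleC_of_real: "complex_of_real a *\<^sub>C x = a *\<^sub>R x"
    and hip_add_left: "hip (x + y) z = hip x z + hip y z"
    and hip_scaleC_left: "hip (c *\<^sub>C x) y = c * hip x y"
    and hip_commute: "hip y x = cnj (hip x y)"
    and Re_hip: "Re (hip x y) = inner x y"

instantiation complex :: hermitian_vector_space
begin
definition scaleC_complex :: "complex \<Rightarrow> complex \<Rightarrow> complex" where
  "scaleC_complex c x = c * x"
definition hip_complex :: "complex \<Rightarrow> complex \<Rightarrow> complex" where
  "hip_complex x y = x * cnj y"
instance
  by standard
    (auto simp: scaleC_complex_def hip_complex_def algebra_simps scaleR_conv_of_real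
      inner_complex_def)
end

instantiation vec :: (hermitian_vector_space, finite) hermitian_vector_space
begin
definition scaleC_vec :: "complex \<Rightarrow> 'a ^ 'b \<Rightarrow> 'a ^ 'b" where
  "scaleC_vec c x = (\<chi> i. c *\<^sub>C x $ i)"
definition hip_vec :: "'a ^ 'b \<Rightarrow> 'a ^ 'b \<Rightarrow> complex" where
  "hip_vec x y = (\<Sum>i\<in>UNIV. hip (x $ i) (y $ i))"
instance
  by standard
    (auto simp: scaleC_vec_def hip_vec_def vec_eq_iff scaleC_add_right scaleC_add_left
      scaleC_scaleC scaleC_of_real hip_add_left hip_scaleC_left hip_commute[symmetric] Re_hip
      sum.distrib sum_distrib_left inner_vec_def)
end

abbreviation cdim :: "'v::hermitian_vector_space itself \<Rightarrow> nat" where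
  "cdim _ \<equiv> vector_space.dim (scaleC :: complex \<Rightarrow> 'v \<Rightarrow> 'v) UNIV"

definition self_adjoint :: "('v::hermitian_vector_space \<Rightarrow> 'v) \<Rightarrow> bool" where
  "self_adjoint A \<longleftrightarrow>
     Vector_Spaces.linear scaleC scaleC A \<and> (\<forall>x y. hip (A x) y = hip x (A y))"

text \<open>For self-adjoint \<open>A\<close> the number \<open>\<langle>Ax,x\<rangle>\<close> is real; \<open>Re\<close> only changes the type.\<close>

definition F_of :: "('v::hermitian_vector_space \<Rightarrow> 'v) \<Rightarrow> 'v \<Rightarrow> real" where
  "F_of A x = Re (hip (A x) x)"

definition linearly_independent_fields ::
    "('v::real_vector \<Rightarrow> 'v) \<Rightarrow> ('v \<Rightarrow> 'v) \<Rightarrow> bool" where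
  "linearly_independent_fields A B \<longleftrightarrow>
     (\<forall>a b :: real. (\<forall>x. a *\<^sub>R A x + b *\<^sub>R B x = 0) \<longrightarrow> a = 0 \<and> b = 0)"

definition vertical :: "'v::hermitian_vector_space \<Rightarrow> 'v set" where
  "vertical x = range (\<lambda>c. c *\<^sub>C x)"

definition horizontal :: "'v::hermitian_vector_space \<Rightarrow> 'v set" where
  "horizontal x = {v. \<forall>w\<in>vertical x. hip v w = 0}"


section \<open>Riemannian metrics on open subsets of a Euclidean space\<close>

primrec higher_differentiable_on ::
    "'a::euclidean_space set \<Rightarrow> ('a \<Rightarrow> 'b::real_normed_vector) \<Rightarrow> nat \<Rightarrow> bool" where
  "higher_differentiable_on U f 0 \<longleftrightarrow> continuous_on U f"
| "higher_differentiable_on U f (Suc n) \<longleftrightarrow>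
     (\<forall>x\<in>U. f differentiable (at x)) \<and>
     (\<forall>v. higher_differentiable_on U (\<lambda>x. frechet_derivative f (at x) v) n)"

text \<open>Intended for open \<open>U\<close> only, where this is the usual notion of a \<open>C\<^sup>\<infinity>\<close> function.\<close>

definition smooth_on ::
    "'a::euclidean_space set \<Rightarrow> ('a \<Rightarrow> 'b::real_normed_vector) \<Rightarrow> bool" where
  "smooth_on U f \<longleftrightarrow> (\<forall>n. higher_differentiable_on U f n)"

text \<open>
  All tangent spaces are identified with the ambient vector space: a metric is a function
  \<open>g\<close> with \<open>g x u v = g\<^sub>x(u,v)\<close>, and a vector field is a function \<open>'a \<Rightarrow> 'a\<close>. Constant fields play
  the role of coordinate fields.
\<close>

type_synonym 'a metric_tensor = "'a \<Rightarrow> 'a \<Rightarrow> 'a \<Rightarrow> real"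

definition riemannian_metric_on :: "'a::euclidean_space set \<Rightarrow> 'a metric_tensor \<Rightarrow> bool" where
  "riemannian_metric_on U g \<longleftrightarrow>
     (\<forall>x\<in>U. bilinear (g x) \<and> (\<forall>u v. g x u v = g x v u) \<and> (\<forall>u. u \<noteq> 0 \<longrightarrow> 0 < g x u u)) \<and>
     (\<forall>u v. smooth_on U (\<lambda>x. g x u v))"

text \<open>The vector \<open>g\<^sub>x\<close>-dual to a covector.\<close>

definition sharp :: "'a::euclidean_space metric_tensor \<Rightarrow> 'a \<Rightarrow> ('a \<Rightarrow> real) \<Rightarrow> 'a" where
  "sharp g x \<alpha> = (THE w. \<forall>z. g x w z = \<alpha> z)"

definition gradient ::
    "'a::euclidean_space metric_tensor \<Rightarrow> ('a \<Rightarrow> real) \<Rightarrow> 'a \<Rightarrow> 'a" where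
  "gradient g \<tau> x = sharp g x (frechet_derivative \<tau> (at x))"

text \<open>Koszul formula for constant fields.\<close>

definition christoffel :: "'a::euclidean_space metric_tensor \<Rightarrow> 'a \<Rightarrow> 'a \<Rightarrow> 'a \<Rightarrow> 'a" where
  "christoffel g x u v = sharp g x (\<lambda>z.
     (frechet_derivative (\<lambda>y. g y v z) (at x) u
      + frechet_derivative (\<lambda>y. g y u z) (at x) v
      - frechet_derivative (\<lambda>y. g y u v) (at x) z) / 2)"

definition levi_civita ::
    "'a::euclidean_space metric_tensor \<Rightarrow> ('a \<Rightarrow> 'a) \<Rightarrow> ('a \<Rightarrow> 'a) \<Rightarrow> 'a \<Rightarrow> 'a" where
  "levi_civita g X Y x = frechet_derivative Y (at x) (X x) + christoffel g x (X x) (Y x)"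

text \<open>
  \<open>R(u,v)w = \<nabla>\<^sub>u\<nabla>\<^sub>vw - \<nabla>\<^sub>v\<nabla>\<^sub>uw\<close>, with \<open>u\<close>, \<open>v\<close>, \<open>w\<close> extended to constant fields, whose brackets vanish.
\<close>

definition curvature ::
    "'a::euclidean_space metric_tensor \<Rightarrow> 'a \<Rightarrow> 'a \<Rightarrow> 'a \<Rightarrow> 'a \<Rightarrow> 'a" where
  "curvature g x u v w =
     levi_civita g (\<lambda>_. u) (levi_civita g (\<lambda>_. v) (\<lambda>_. w)) x
     - levi_civita g (\<lambda>_. v) (levi_civita g (\<lambda>_. u) (\<lambda>_. w)) x"

text \<open>The trace of a linear operator, computed in the (arbitrary) basis \<^const>\<open>Basis\<close>.\<close>

definition op_trace :: "('a::euclidean_space \<Rightarrow> 'a) \<Rightarrow> real" where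
  "op_trace L = (\<Sum>b\<in>Basis. inner (L b) b)"

definition ricci :: "'a::euclidean_space metric_tensor \<Rightarrow> 'a \<Rightarrow> 'a \<Rightarrow> 'a \<Rightarrow> real" where
  "ricci g x v w = op_trace (\<lambda>u. curvature g x u v w)"

definition ricci_op :: "'a::euclidean_space metric_tensor \<Rightarrow> 'a \<Rightarrow> 'a \<Rightarrow> 'a" where
  "ricci_op g x v = sharp g x (ricci g x v)"

definition scalar_curvature :: "'a::euclidean_space metric_tensor \<Rightarrow> 'a \<Rightarrow> real" where
  "scalar_curvature g x = op_trace (ricci_op g x)"

definition hessian_op ::
    "'a::euclidean_space metric_tensor \<Rightarrow> ('a \<Rightarrow> real) \<Rightarrow> 'a \<Rightarrow> 'a \<Rightarrow> 'a" where
  "hessian_op g \<tau> x v = levi_civita g (\<lambda>_. v) (gradient g \<tau>) x"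

text \<open>The last conjunct is the vanishing of the Lie derivative of \<open>g\<close> along \<open>X\<close>.\<close>

definition killing_field_on ::
    "'a::euclidean_space set \<Rightarrow> 'a metric_tensor \<Rightarrow> ('a \<Rightarrow> 'a) \<Rightarrow> bool" where
  "killing_field_on U g X \<longleftrightarrow>
     smooth_on U X \<and>
     (\<forall>x\<in>U. \<forall>u v.
        frechet_derivative (\<lambda>y. g y u v) (at x) (X x)
        + g x (frechet_derivative X (at x) u) v
        + g x u (frechet_derivative X (at x) v) = 0)"

definition is_eigenvector :: "('a::real_vector \<Rightarrow> 'a) \<Rightarrow> 'a \<Rightarrow> bool" where
  "is_eigenvector L w \<longleftrightarrow> w \<noteq> 0 \<and> (\<exists>c::real. L w = c *\<^sub>R w)"


section \<open>Kaehler and SKR metrics\<close>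

abbreviation cstruct :: "'v::hermitian_vector_space \<Rightarrow> 'v" (\<open>\<J>\<close>) where
  "\<J> v \<equiv> \<i> *\<^sub>C v"

definition kaehler_form ::
    "'v::hermitian_vector_space metric_tensor \<Rightarrow> 'v \<Rightarrow> 'v \<Rightarrow> 'v \<Rightarrow> real" where
  "kaehler_form g x u v = g x (\<J> u) v"

text \<open>\<open>d\<omega> = 0\<close>, with the exterior derivative evaluated on constant fields.\<close>

definition closed_two_form_on ::
    "'a::euclidean_space set \<Rightarrow> ('a \<Rightarrow> 'a \<Rightarrow> 'a \<Rightarrow> real) \<Rightarrow> bool" where
  "closed_two_form_on U \<omega> \<longleftrightarrow>
     (\<forall>x\<in>U. \<forall>u v w.
        frechet_derivative (\<lambda>y. \<omega> y v w) (at x) u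
        + frechet_derivative (\<lambda>y. \<omega> y w u) (at x) v
        + frechet_derivative (\<lambda>y. \<omega> y u v) (at x) w = 0)"

text \<open>\<open>J\<close>-invariance of \<open>g\<close> is what makes \<open>\<omega>\<close> skew-symmetric.\<close>

definition kaehler_metric_on ::
    "'v::hermitian_vector_space set \<Rightarrow> 'v metric_tensor \<Rightarrow> bool" where
  "kaehler_metric_on U g \<longleftrightarrow>
     riemannian_metric_on U g \<and>
     (\<forall>x\<in>U. \<forall>u v. g x (\<J> u) (\<J> v) = g x u v) \<and>
     closed_two_form_on U (kaehler_form g)"

definition killing_potential_on ::
    "'v::hermitian_vector_space set \<Rightarrow> 'v metric_tensor \<Rightarrow> ('v \<Rightarrow> real) \<Rightarrow> bool" where
  "killing_potential_on U g \<tau> \<longleftrightarrow>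
     smooth_on U \<tau> \<and> killing_field_on U g (\<lambda>x. \<J> (gradient g \<tau> x))"

text \<open>
  The potential has to be nonconstant: otherwise every Kaehler metric would qualify, by a
  constant \<open>\<tau>\<close>.
\<close>

definition SKR_metric_on ::
    "'v::hermitian_vector_space set \<Rightarrow> 'v metric_tensor \<Rightarrow> bool" where
  "SKR_metric_on U g \<longleftrightarrow>
     kaehler_metric_on U g \<and>
     (\<exists>\<tau>. killing_potential_on U g \<tau> \<and> \<not> \<tau> constant_on U \<and>
        (\<forall>x\<in>U. frechet_derivative \<tau> (at x) \<noteq> (\<lambda>_. 0) \<longrightarrow>
           (\<forall>w. w \<noteq> 0 \<and> (\<forall>c. g x w (c *\<^sub>C gradient g \<tau> x) = 0) \<longrightarrow>
              is_eigenvector (ricci_op g x) w \<and> is_eigenvector (hessian_op g \<tau> x) w)))"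

text \<open>\<open>\<phi>\<close> is a potential on \<open>U\<close> of the linear field \<open>x \<mapsto> Ax\<close>, that is, \<open>g(Ax,\<cdot>) = d\<phi>\<close>.\<close>

definition holomorphy_potential_on ::
    "'v::hermitian_vector_space set \<Rightarrow> 'v metric_tensor \<Rightarrow> ('v \<Rightarrow> 'v) \<Rightarrow> ('v \<Rightarrow> real) \<Rightarrow> bool"
  where
  "holomorphy_potential_on U g A \<phi> \<longleftrightarrow> (\<forall>x\<in>U. (\<phi> has_derivative g x (A x)) (at x))"

text \<open>
  \<open>g = S(r) Re\<langle>\<cdot>,\<cdot>\<rangle>\<^sub>V + T(r) Re\<langle>\<cdot>,\<cdot>\<rangle>\<^sub>H\<close> on the punctured space, with \<open>r = norm x\<close>; \<open>V\<close> and \<open>H\<close> are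
  \<open>g\<close>-orthogonal.
\<close>

definition has_VH_form ::
    "'v::hermitian_vector_space metric_tensor \<Rightarrow> (real \<Rightarrow> real) \<Rightarrow> (real \<Rightarrow> real) \<Rightarrow> bool" where
  "has_VH_form g S T \<longleftrightarrow>
     (\<forall>x. x \<noteq> 0 \<longrightarrow>
        (\<forall>u\<in>vertical x. \<forall>v\<in>vertical x. g x u v = S (norm x) * Re (hip u v)) \<and>
        (\<forall>u\<in>horizontal x. \<forall>v\<in>horizontal x. g x u v = T (norm x) * Re (hip u v)) \<and>
        (\<forall>u\<in>vertical x. \<forall>v\<in>horizontal x. g x u v = 0))"

text \<open>
  All self-adjoint linear fields are \<open>g\<close>-gradient, and their holomorphy potentials on the
  punctured space are exactly the functions \<open>F T / 2 + C\<close>.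
\<close>

definition potentials_given_by ::
    "'v::hermitian_vector_space metric_tensor \<Rightarrow> (real \<Rightarrow> real) \<Rightarrow> bool" where
  "potentials_given_by g T \<longleftrightarrow>
     (\<forall>A. self_adjoint A \<longrightarrow>
        (\<forall>\<phi>. holomorphy_potential_on (- {0}) g A \<phi> \<longleftrightarrow>
              (\<exists>C. \<forall>x. x \<noteq> 0 \<longrightarrow> \<phi> x = F_of A x * T (norm x) / 2 + C)))"

end

theory Submission
  imports Defs
begin

text \<open>
  Write \<open>t = \<bar>x\<bar>\<^sup>2\<close>, \<open>f(t) = T(\<surd>t)\<close> and \<open>k(t) = (S(\<surd>t) - T(\<surd>t)) / t\<close>. The orthogonal projection of \<open>u\<close> onto
  the complex line of \<open>x\<close> is \<open>(\<langle>u,x\<rangle>/t) x\<close>, so that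
  \<open>g\<^sub>x(u,v) = f(t) Re\<langle>u,v\<rangle> + k(t) Re(\<langle>u,x\<rangle>\<langle>x,v\<rangle>)\<close>, and the differential equation
  \<open>S = T + (r/2) T\<^sub>r\<close> says that \<open>k\<close> is the derivative \<open>f'\<close>.

  Every condition of the first part is compared with \<open>k = f'\<close>. If \<open>\<alpha> = Re\<langle>x,\<cdot>\<rangle>\<close> and \<open>\<omega>\<^sub>0\<close> is the flat
  Kaehler form, then \<open>d\<omega> = 2 (f' - k) \<alpha> \<and> \<omega>\<^sub>0\<close>, and \<open>\<alpha> \<and> \<omega>\<^sub>0\<close> vanishes nowhere in complex dimension at
  least two. For self-adjoint \<open>A\<close> one has
  \<open>d(F T / 2) = g(Ax,\<cdot>) + (f' - k) F \<alpha>\<close>, and \<open>F = t\<close> for \<open>A = Id\<close>; the constant in the potential is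
  unique because the punctured space is connected. It remains to see that \<open>k = f'\<close> makes \<open>g\<close> an SKR metric.
  The potential is \<open>\<tau> = t f(t) / 2\<close>, whose gradient is the radial field \<open>x\<close>, and \<open>J\<nabla>\<tau>\<close> is the field
  \<open>x \<mapsto> ix\<close>, an infinitesimal isometry. The Christoffel tensor is complex bilinear,
  \<open>\<Gamma>(u,v) = p(t)(\<langle>u,x\<rangle> v + \<langle>v,x\<rangle> u) + q(t) \<langle>u,x\<rangle>\<langle>v,x\<rangle> x\<close>, hence the curvature is the antilinear part of
  its derivative. Taking traces yields
  \<open>Ric(v,w) = a(t) Re\<langle>v,w\<rangle> + b(t) Re(\<langle>v,x\<rangle>\<langle>x,w\<rangle>)\<close>. Therefore vectors orthogonal to the complex line
  of \<open>x\<close> are eigenvectors of the Ricci tensor and of the Hessian of \<open>\<tau>\<close>, and the scalar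
  curvature is a function of \<open>t\<close> only.

  For the second part, fix a sphere. On it \<open>p(s)\<close> is a constant, so that \<open>F\<^sub>2\<close> is a differentiable function
  \<open>\<psi>\<close> of \<open>F\<^sub>1\<close>. Eigenvectors \<open>e, e'\<close> of \<open>A\<^sub>1\<close> for the largest and the smallest eigenvalue are critical for
  \<open>F\<^sub>1\<close>, hence for \<open>F\<^sub>2\<close>; along the great circle through them both \<open>F\<^sub>1\<close> and \<open>F\<^sub>2\<close> are affine in
  \<open>cos\<^sup>2 \<theta>\<close>, while \<open>F\<^sub>1\<close> takes all its values there. So \<open>\<psi>\<close> is affine and \<open>A\<^sub>2 = a A\<^sub>1 + b Id\<close>
  (\<open>quadratic_forms_dependent\<close>), where \<open>b \<noteq> 0\<close> by linear independence. The equation becomes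
  \<open>a \<mu> \<tau> + b \<tau> + c = P(\<tau>) h(C + \<mu> \<tau>)\<close>, with \<open>\<mu>\<close> in the range of \<open>F\<^sub>1\<close> on the unit sphere. If
  \<open>y, z\<close> are two arguments of \<open>h\<close> that both occur for two values of \<open>\<tau>\<close>, then eliminating \<open>P\<close> gives
  \<open>b h(y) = b h(z)\<close>; so \<open>h\<close> is locally constant (\<open>separated_affine_function_constant\<close>).
\<close>


section \<open>Complex scaling and the hermitian product\<close>

lemma hip_add_right: "hip x (y + z) = hip x y + hip x z"
  by (metis hip_add_left hip_commute complex_cnj_add)

lemma hip_scaleC_right: "hip x (c *\<^sub>C y) = cnj c * hip x y"
  by (metis hip_scaleC_left hip_commute complex_cnj_mult)

lemma hip_scaleR_left: "hip (a *\<^sub>R x) y = of_real a * hip x y"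
  by (metis hip_scaleC_left scaleC_of_real)

lemma hip_scaleR_right: "hip x (a *\<^sub>R y) = of_real a * hip x y"
  by (metis hip_scaleC_right scaleC_of_real complex_cnj_complex_of_real)

lemma hip_self: "hip x x = of_real (x \<bullet> x)"
proof -
  have "Im (hip x x) = 0"
    using arg_cong[OF hip_commute[of x x], of Im] by simp
  then show ?thesis by (simp add: complex_eq_iff Re_hip)
qed

lemma hip_zero_left [simp]: "hip 0 y = 0"
  using hip_scaleR_left[of 0 0 y] by simp

lemma hip_zero_right [simp]: "hip x 0 = 0"
  using hip_scaleR_right[of x 0 0] by simp

lemma hip_minus_left: "hip (- x) y = - hip x y"
  using hip_scaleR_left[of "-1" x y] by simp

lemma hip_diff_left: "hip (x - y) z = hip x z - hip y z"
  using hip_add_left[of x "-y" z] by (simp add: hip_minus_left)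

lemma norm_scaleC: "norm (c *\<^sub>C x) = cmod c * norm x"
proof -
  have "of_real ((c *\<^sub>C x) \<bullet> (c *\<^sub>C x)) = c * cnj c * of_real (x \<bullet> x)"
    by (simp add: hip_self[symmetric] hip_scaleC_left hip_scaleC_right)
  then have "(c *\<^sub>C x) \<bullet> (c *\<^sub>C x) = (cmod c)\<^sup>2 * (x \<bullet> x)"
    by (metis complex_norm_square of_real_eq_iff of_real_mult)
  then show ?thesis
    by (simp add: norm_eq_sqrt_inner real_sqrt_mult)
qed

text \<open>
  The real Cauchy-Schwarz inequality, applied after a rotation of \<open>x\<close> by the phase that makes the
  product real.
\<close>

lemma cmod_hip_le: "cmod (hip x y) \<le> norm x * norm y"
proof (cases "hip x y = 0")
  case False
  \<comment> \<open>The unit complex number with \<open>c * hip x y = cmod (hip x y)\<close>.\<close>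
  define c where "c = cnj (hip x y) / cmod (hip x y)"
  have "c * hip x y = cmod (hip x y)" 
    using False unfolding c_def
    by (simp add: field_simps) (metis complex_norm_square mult.commute power2_eq_square of_real_mult)
  then have "cmod (hip x y) = (c *\<^sub>C x) \<bullet> y"
    by (metis Re_complex_of_real Re_hip hip_scaleC_left)
  also have "\<dots> \<le> norm (c *\<^sub>C x) * norm y"
    by (rule norm_cauchy_schwarz)
  also have "norm (c *\<^sub>C x) = norm x"
    using False by (simp add: norm_scaleC c_def norm_divide)
  finally show ?thesis .
qed simp

interpretation cvs: vector_space "scaleC :: complex \<Rightarrow> 'v::hermitian_vector_space \<Rightarrow> 'v"
  by standard (auto simp: scaleC_add_right scaleC_add_left scaleC_scaleC scaleC_of_real[of 1, simplified])

lemma bounded_bilinear_scaleC: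
  "bounded_bilinear (scaleC :: complex \<Rightarrow> 'v::hermitian_vector_space \<Rightarrow> 'v)"
proof
  fix r :: real and a :: complex and b :: 'v
  show "(r *\<^sub>R a) *\<^sub>C b = r *\<^sub>R (a *\<^sub>C b)" 
    unfolding scaleR_conv_of_real by (metis scaleC_scaleC scaleC_of_real)
  show "a *\<^sub>C (r *\<^sub>R b) = r *\<^sub>R (a *\<^sub>C b)"
    by (metis scaleC_scaleC scaleC_of_real mult.commute)
  show "\<exists>K. \<forall>(a::complex) (b::'v). norm (a *\<^sub>C b) \<le> norm a * norm b * K"
    by (rule exI[of _ 1]) (simp add: norm_scaleC)
qed (simp_all add: scaleC_add_right scaleC_add_left)

lemma bounded_bilinear_hip:
  "bounded_bilinear (hip :: 'v::hermitian_vector_space \<Rightarrow> 'v \<Rightarrow> complex)"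
proof
  show "\<exists>K. \<forall>(a::'v) b. norm (hip a b) \<le> norm a * norm b * K"
    by (rule exI[of _ 1]) (simp add: cmod_hip_le)
qed (simp_all add: hip_add_left hip_add_right hip_scaleR_left hip_scaleR_right scaleR_conv_of_real)

lemmas has_derivative_hip [derivative_intros] = bounded_bilinear.FDERIV[OF bounded_bilinear_hip]
lemmas has_derivative_scaleC [derivative_intros] = bounded_bilinear.FDERIV[OF bounded_bilinear_scaleC]

text \<open>
  A vector outside the complex line of \<open>x\<close> exists for dimensional reasons; subtract from it its projection.
\<close>

lemma exists_horizontal:
  fixes x :: "'v::hermitian_vector_space"
  assumes "2 \<le> cdim TYPE('v)" "x \<noteq> 0"
  obtains w where "w \<noteq> 0" "hip w x = 0"
proof -
  have "cvs.span {x} \<noteq> (UNIV :: 'v set)"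
  proof
    assume "cvs.span {x} = UNIV"
    then have "cdim TYPE('v) \<le> card {x}"
      by (intro cvs.dim_le_card) auto
    with assms show False by simp
  qed
  then obtain y where y: "\<And>c. y \<noteq> c *\<^sub>C x"
    by (auto simp: cvs.span_singleton)
  show ?thesis
  proof
    show "y - (hip y x / of_real (x \<bullet> x)) *\<^sub>C x \<noteq> 0" using y by simp
    show "hip (y - (hip y x / of_real (x \<bullet> x)) *\<^sub>C x) x = 0"
      using assms by (simp add: hip_diff_left hip_scaleC_left hip_self)
  qed
qed

lemma two_le_DIM:
  assumes "2 \<le> cdim TYPE('v::hermitian_vector_space)"
  shows "2 \<le> DIM('v)"
proof -
  obtain x :: 'v where x: "x \<noteq> 0"
    using nonempty_Basis nonzero_Basis by blast
  have o: "x \<bullet> (\<J> x) = 0"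
    using hip_self[of x] by (metis Re_hip hip_scaleC_right Re_i_times Im_complex_of_real add.inverse_inverse complex_cnj_i mult_minus_left neg_equal_0_iff_equal uminus_complex.simps(1))
  moreover have J: "\<J> x \<noteq> 0" using x by simp
  ultimately have "independent {x, \<J> x}"
    using x by (intro pairwise_orthogonal_independent) (auto simp: pairwise_def orthogonal_def inner_commute)
  then have "card {x, \<J> x} \<le> DIM('v)"
    by (rule independent_bound[THEN conjunct2])
  moreover have "x \<noteq> \<J> x" using x o by auto
  ultimately show ?thesis by simp
qed

lemma connected_punctured:
  assumes "2 \<le> cdim TYPE('v::hermitian_vector_space)"
  shows "connected (- {0::'v})"
  using two_le_DIM[OF assms] by (rule connected_punctured_universe)

lemma cnj_hip [simp]: "cnj (hip x y) = hip y x"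
  by (rule hip_commute[symmetric])

lemmas hip_simps = hip_add_left hip_add_right hip_scaleC_left hip_scaleC_right hip_minus_left hip_diff_left

lemma inner_eq_Re_hip: "x \<bullet> a = Re (hip a x)"
  by (simp add: Re_hip inner_commute)

lemma self_adjoint_inner: "self_adjoint A \<Longrightarrow> A x \<bullet> y = x \<bullet> A y"
  unfolding self_adjoint_def by (metis Re_hip)

lemma self_adjoint_linear:
  assumes "self_adjoint A"
  shows "linear A"
proof -
  have "A (u + v) = A u + A v" "A (c *\<^sub>C u) = c *\<^sub>C A u" for u v c
    using assms unfolding self_adjoint_def Vector_Spaces.linear_iff by auto
  then show ?thesis
    by (intro linearI) (simp_all add: scaleC_of_real[symmetric])
qed

lemma self_adjoint_ident: "self_adjoint (\<lambda>x::'v::hermitian_vector_space. x)"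
  by (simp add: self_adjoint_def Vector_Spaces.linear_iff cvs.vector_space_axioms)

section \<open>Calculus of smooth functions\<close>

text \<open>
  Locally equal functions have the same candidates for a derivative, and the derivative is chosen among
  these; this covers points of non-differentiability as well.
\<close>

lemma frechet_derivative_transform_open:
  assumes "open U" "x \<in> U" "\<And>y. y \<in> U \<Longrightarrow> f y = h y"
  shows "frechet_derivative f (at x) = frechet_derivative h (at x)"
proof -
  have "(f has_derivative D) (at x) \<longleftrightarrow> (h has_derivative D) (at x)" for D
    using assms has_derivative_transform_within_open[of f D x UNIV U h]
      has_derivative_transform_within_open[of h D x UNIV U f] by auto
  then show ?thesis by (simp add: frechet_derivative_def)
qed

lemma higher_differentiable_on_cong:
  assumes "open U" "\<And>x. x \<in> U \<Longrightarrow> f x = h x"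
  shows "higher_differentiable_on U f n \<longleftrightarrow> higher_differentiable_on U h n"
  using assms(2)
proof (induction n arbitrary: f h)
  case 0
  then show ?case by (simp cong: continuous_on_cong)
next
  case (Suc n)
  have "f differentiable at x \<longleftrightarrow> h differentiable at x" if "x \<in> U" for x
    using Suc.prems that assms(1) has_derivative_transform_within_open[of f _ x UNIV U h]
      has_derivative_transform_within_open[of h _ x UNIV U f]
    unfolding differentiable_def by fastforce
  moreover have "higher_differentiable_on U (\<lambda>x. frechet_derivative f (at x) v) n \<longleftrightarrow>
      higher_differentiable_on U (\<lambda>x. frechet_derivative h (at x) v) n" for v
    by (rule Suc.IH) (use frechet_derivative_transform_open[OF assms(1) _ Suc.prems] in simp)
  ultimately show ?case by simp
qed

lemma higher_differentiable_on_Suc_imp: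
  "higher_differentiable_on U f (Suc n) \<Longrightarrow> higher_differentiable_on U f n"
proof (induction n arbitrary: f)
  case 0
  then show ?case
    by (auto intro!: continuous_at_imp_continuous_on differentiable_imp_continuous_within)
qed auto

lemma higher_differentiable_on_const: "higher_differentiable_on U (\<lambda>_. c) n"
  by (induction n arbitrary: c) auto

lemma higher_differentiable_on_bounded_linear:
  assumes "bounded_linear L"
  shows "higher_differentiable_on U L n"
proof (cases n)
  case 0
  then show ?thesis using assms by (simp add: linear_continuous_on)
next
  case (Suc m)
  have "(L has_derivative L) (at x)" for x
    using assms by (simp add: bounded_linear_imp_has_derivative)
  then have "frechet_derivative L (at x) = L" and "L differentiable (at x)" for x
    using frechet_derivative_at[of L L x] by (auto intro: differentiableI)
  then show ?thesis using Suc by (simp add: higher_differentiable_on_const)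
qed

lemma higher_differentiable_on_add:
  assumes "open U" "higher_differentiable_on U f n" "higher_differentiable_on U h n"
  shows "higher_differentiable_on U (\<lambda>x. f x + h x) n"
  using assms(2,3)
proof (induction n arbitrary: f h)
  case (Suc n)
  have "((\<lambda>x. f x + h x) has_derivative
     (\<lambda>v. frechet_derivative f (at x) v + frechet_derivative h (at x) v)) (at x)" if "x \<in> U" for x
    using Suc.prems that by (auto intro!: has_derivative_add simp: frechet_derivative_works[symmetric])
  note D = this
  have "higher_differentiable_on U (\<lambda>x. frechet_derivative (\<lambda>x. f x + h x) (at x) v) n" for v
  proof (subst higher_differentiable_on_cong[OF assms(1)])
    show "frechet_derivative (\<lambda>x. f x + h x) (at x) v = frechet_derivative f (at x) v + frechet_derivative h (at x) v"
      if "x \<in> U" for x using frechet_derivative_at[OF D[OF that]] by metis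
  qed (use Suc in auto)
  then show ?case using D by (auto intro: differentiableI)
qed (auto intro: continuous_on_add)

lemma higher_differentiable_on_sum:
  assumes "open U" "finite I" "\<And>i. i \<in> I \<Longrightarrow> higher_differentiable_on U (f i) n"
  shows "higher_differentiable_on U (\<lambda>x. \<Sum>i\<in>I. f i x) n"
  using assms(2,3)
  by (induction I rule: finite_induct)
    (auto intro!: higher_differentiable_on_add higher_differentiable_on_const assms(1))

lemma higher_differentiable_on_mult:
  fixes f h :: "'a::euclidean_space \<Rightarrow> real"
  assumes "open U" "higher_differentiable_on U f n" "higher_differentiable_on U h n"
  shows "higher_differentiable_on U (\<lambda>x. f x * h x) n"
  using assms(2,3)
proof (induction n arbitrary: f h)
  case (Suc n)
  have "((\<lambda>x. f x * h x) has_derivative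
     (\<lambda>v. f x * frechet_derivative h (at x) v + frechet_derivative f (at x) v * h x)) (at x)" if "x \<in> U" for x
    using Suc.prems that by (auto intro!: has_derivative_mult simp: frechet_derivative_works[symmetric])
  note D = this
  have "higher_differentiable_on U (\<lambda>x. frechet_derivative (\<lambda>x. f x * h x) (at x) v) n" for v
  proof (subst higher_differentiable_on_cong[OF assms(1)])
    show "frechet_derivative (\<lambda>x. f x * h x) (at x) v = f x * frechet_derivative h (at x) v + frechet_derivative f (at x) v * h x"
      if "x \<in> U" for x using frechet_derivative_at[OF D[OF that]] by metis
  qed (use Suc higher_differentiable_on_Suc_imp[OF Suc.prems(1)] higher_differentiable_on_Suc_imp[OF Suc.prems(2)]
      in \<open>auto intro!: higher_differentiable_on_add assms(1)\<close>)
  then show ?case using D by (auto intro: differentiableI)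
qed (auto intro: continuous_on_mult)

lemma smooth_on_imp_differentiable: "smooth_on U f \<Longrightarrow> x \<in> U \<Longrightarrow> f differentiable at x"
  unfolding smooth_on_def by (metis higher_differentiable_on.simps(2))

lemma smooth_on_deriv:
  fixes f :: "real \<Rightarrow> real"
  assumes "open U" "smooth_on U f"
  shows "smooth_on U (deriv f)" "x \<in> U \<Longrightarrow> (f has_real_derivative deriv f x) (at x)"
proof -
  show D: "(f has_real_derivative deriv f x) (at x)" if "x \<in> U" for x
    using smooth_on_imp_differentiable[OF assms(2) that]
    by (simp add: DERIV_deriv_iff_real_differentiable)
  have "frechet_derivative f (at x) 1 = deriv f x" if "x \<in> U" for x
    using frechet_derivative_at[OF D[OF that, unfolded has_field_derivative_def]] by (metis mult_1_right)
  then show "smooth_on U (deriv f)"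
    using assms higher_differentiable_on_cong[OF assms(1), of "\<lambda>x. frechet_derivative f (at x) 1" "deriv f"]
    unfolding smooth_on_def by (metis higher_differentiable_on.simps(2))
qed

section \<open>Kaehler form and holomorphy potentials of a radial hermitian metric\<close>

text \<open>
  All coefficients of the metric and of its connection are functions of \<open>x \<bullet> x\<close>, and are differentiated in this way.
\<close>

lemma has_derivative_radial:
  assumes "(h has_real_derivative h') (at (x \<bullet> x))"
  shows "((\<lambda>y. h (y \<bullet> y)) has_derivative (\<lambda>a. 2 * h' * (x \<bullet> a))) (at x)"
proof -
  have "((\<lambda>y. y \<bullet> y) has_derivative (\<lambda>a. 2 * (x \<bullet> a))) (at x)"
    by (auto intro!: derivative_eq_intros simp: inner_commute)
  from has_derivative_compose[OF this, of h "(*) h'"] assms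
  show ?thesis by (simp add: has_field_derivative_def mult.left_commute mult.assoc)
qed

lemma sharp_eqI:
  assumes "riemannian_metric_on U g" "x \<in> U" "\<And>z. g x w z = \<alpha> z"
  shows "sharp g x \<alpha> = w"
  unfolding sharp_def
proof (rule the_equality)
  fix w' assume w': "\<forall>z. g x w' z = \<alpha> z"
  have "bilinear (g x)" and pos: "\<And>u. u \<noteq> 0 \<Longrightarrow> 0 < g x u u"
    using assms(1,2) unfolding riemannian_metric_on_def by auto
  then have "g x (w' - w) (w' - w) = 0"
    using w' assms(3) by (simp add: bilinear_lsub)
  then show "w' = w" using pos[of "w' - w"] by force
qed (use assms in auto)

text \<open>
  The coefficients are functions of \<open>t = x \<bullet> x\<close> instead of the norm: its derivative \<open>2 (x \<bullet> a)\<close> is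
  polynomial, so that all later identities are polynomial in hermitian products. Here \<open>f1\<close> stands for
  \<open>f'\<close>, and the metric is Kaehler exactly if \<open>k = f1\<close>.
\<close>

locale radial_hermitian_metric =
  fixes g :: "'v::hermitian_vector_space metric_tensor" and f f1 k :: "real \<Rightarrow> real"
  assumes riemannian: "riemannian_metric_on (- {0}) g"
    and metric_eq: "x \<noteq> 0 \<Longrightarrow>
      g x u v = f (x \<bullet> x) * Re (hip u v) + k (x \<bullet> x) * Re (hip u x * hip x v)"
    and f_pos: "0 < t \<Longrightarrow> 0 < f t"
    and DERIV_f: "0 < t \<Longrightarrow> (f has_real_derivative f1 t) (at t)"
    and DERIV_k: "0 < t \<Longrightarrow> (k has_real_derivative deriv k t) (at t)"
begin

text \<open>
  On the vertical vector \<open>x\<close> the metric takes the value \<open>t (f + t k)\<close>, so the second factor is the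
  coefficient \<open>S\<close> of its vertical part.
\<close>

lemma f_plus_pos:
  assumes "x \<noteq> (0::'v)"
  shows "0 < f (x \<bullet> x) + (x \<bullet> x) * k (x \<bullet> x)"
proof -
  have "0 < g x x x"
    using riemannian assms by (auto simp: riemannian_metric_on_def)
  also have "g x x x = (x \<bullet> x) * (f (x \<bullet> x) + (x \<bullet> x) * k (x \<bullet> x))"
    using assms by (simp add: metric_eq hip_self algebra_simps)
  finally show ?thesis
    using assms zero_less_mult_pos by (metis inner_gt_zero_iff)
qed

lemma has_derivative_metric:
  assumes "x \<noteq> 0"
  shows "((\<lambda>y. g y u v) has_derivative (\<lambda>a.
    2 * f1 (x \<bullet> x) * (x \<bullet> a) * Re (hip u v) + 2 * deriv k (x \<bullet> x) * (x \<bullet> a) * Re (hip u x * hip x v)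
    + k (x \<bullet> x) * Re (hip u a * hip x v + hip u x * hip a v))) (at x)"
proof -
  have t: "0 < x \<bullet> x" using assms by simp
  have R: "((\<lambda>y. Re (hip u y * hip y v)) has_derivative
     (\<lambda>a. Re (hip u a * hip x v + hip u x * hip a v))) (at x)"
    by (rule derivative_eq_intros refl ext | simp add: algebra_simps)+
  have "((\<lambda>y. f (y \<bullet> y) * Re (hip u v) + k (y \<bullet> y) * Re (hip u y * hip y v)) has_derivative (\<lambda>a.
    2 * f1 (x \<bullet> x) * (x \<bullet> a) * Re (hip u v) + 2 * deriv k (x \<bullet> x) * (x \<bullet> a) * Re (hip u x * hip x v)
    + k (x \<bullet> x) * Re (hip u a * hip x v + hip u x * hip a v))) (at x)"
    using has_derivative_add[OF has_derivative_mult_left[OF has_derivative_radial[OF DERIV_f[OF t]]]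
        has_derivative_mult[OF has_derivative_radial[OF DERIV_k[OF t]] R]]
    by (rule has_derivative_eq_rhs) (simp add: fun_eq_iff)
  then show ?thesis
    by (rule has_derivative_transform_within_open[of _ _ _ _ "- {0}"])
      (use assms in \<open>auto simp: metric_eq open_Compl\<close>)
qed

lemmas frechet_derivative_metric = frechet_derivative_at[OF has_derivative_metric, symmetric]

lemma metric_cstruct: "x \<noteq> 0 \<Longrightarrow> g x (\<J> u) (\<J> v) = g x u v"
  by (simp add: metric_eq hip_simps)

text \<open>
  This is \<open>d\<omega> = 2 (f' - k) \<alpha> \<and> \<omega>\<^sub>0\<close>. Indeed \<open>\<omega> = f \<omega>\<^sub>0 + k \<alpha> \<and> \<beta>\<close> with \<open>\<beta> = Re\<langle>ix,\<cdot>\<rangle>\<close>, where \<open>d\<beta> = 2 \<omega>\<^sub>0\<close>, and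
  \<open>df\<close> and \<open>dk\<close> are multiples of \<open>\<alpha>\<close>; hence \<open>dk\<close> drops out.
\<close>

lemma exterior_derivative_kaehler_form:
  assumes "x \<noteq> 0"
  shows "frechet_derivative (\<lambda>y. kaehler_form g y v w) (at x) u
        + frechet_derivative (\<lambda>y. kaehler_form g y w u) (at x) v
        + frechet_derivative (\<lambda>y. kaehler_form g y u v) (at x) w =
      2 * (k (x \<bullet> x) - f1 (x \<bullet> x)) *
        ((x \<bullet> u) * Im (hip v w) + (x \<bullet> v) * Im (hip w u) + (x \<bullet> w) * Im (hip u v))"
proof -
  \<comment> \<open>Orienting all products in the same way leaves a polynomial identity in their real and imaginary parts.\<close>
  have h: "hip w u = cnj (hip u w)" "hip w v = cnj (hip v w)" "hip v u = cnj (hip u v)"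
    "hip x u = cnj (hip u x)" "hip x v = cnj (hip v x)" "hip x w = cnj (hip w x)"
    by auto
  show ?thesis
    unfolding kaehler_form_def frechet_derivative_metric[OF assms] inner_eq_Re_hip hip_scaleC_left h
    unfolding complex_mult_cnj times_complex.simps plus_complex.simps cnj.simps imaginary_unit.simps
    by algebra
qed

text \<open>
  Closedness is tested on \<open>x\<close>, \<open>w\<close>, \<open>iw\<close> with \<open>w\<close> horizontal, where \<open>\<alpha> \<and> \<omega>\<^sub>0\<close> does not vanish.
\<close>

lemma kaehler_iff:
  assumes "2 \<le> cdim TYPE('v)"
  shows "kaehler_metric_on (- {0}) g \<longleftrightarrow> (\<forall>t>0. k t = f1 t)"
proof
  assume K: "kaehler_metric_on (- {0}) g"
  show "\<forall>t>0. k t = f1 t"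
  proof (intro allI impI)
    fix t :: real assume "0 < t"
    obtain y :: 'v where y: "norm y = sqrt t"
      using vector_choose_size[of "sqrt t"] \<open>0 < t\<close> by auto
    then have t: "y \<bullet> y = t" using \<open>0 < t\<close> by (simp add: dot_square_norm)
    have "y \<noteq> 0" using t \<open>0 < t\<close> by auto
    obtain w where w: "w \<noteq> 0" "hip w y = 0"
      using exists_horizontal[OF assms \<open>y \<noteq> 0\<close>] by blast
    have "hip y w = 0" using w(2) cnj_hip[of w y] by simp
    then have "2 * (k t - f1 t) * (t * Im (hip w (\<J> w))) = 0"
      using K exterior_derivative_kaehler_form[OF \<open>y \<noteq> 0\<close>, of w "\<J> w" y] \<open>y \<noteq> 0\<close> t w(2)
      unfolding kaehler_metric_on_def closed_two_form_on_def
      by (simp add: hip_scaleC_right hip_scaleC_left inner_eq_Re_hip)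
    moreover have "Im (hip w (\<J> w)) \<noteq> 0"
      using w(1) by (simp add: hip_scaleC_right hip_self)
    ultimately show "k t = f1 t" using \<open>0 < t\<close> by simp
  qed
next
  assume "\<forall>t>0. k t = f1 t"
  then show "kaehler_metric_on (- {0}) g"
    unfolding kaehler_metric_on_def closed_two_form_on_def
    using riemannian metric_cstruct exterior_derivative_kaehler_form by auto
qed

text \<open>
  Self-adjointness makes \<open>\<langle>Ax,x\<rangle>\<close> real, so the second part of \<open>g(Ax,\<cdot>)\<close> is \<open>k F \<alpha>\<close>, to be compared with the
  radial contribution \<open>F f' \<alpha>\<close> to the differential.
\<close>

lemma has_derivative_potential:
  assumes A: "self_adjoint A" and x: "x \<noteq> 0"
  shows "((\<lambda>y. F_of A y * f (y \<bullet> y) / 2) has_derivative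
    (\<lambda>a. g x (A x) a + (f1 (x \<bullet> x) - k (x \<bullet> x)) * F_of A x * (x \<bullet> a))) (at x)"
proof -
  have sa: "hip (A u) v = hip u (A v)" for u v
    using A unfolding self_adjoint_def by auto
  have "linear A" by (rule self_adjoint_linear[OF A])
  then have A': "(A has_derivative A) (at x)"
    by (simp add: linear_conv_bounded_linear bounded_linear_imp_has_derivative)
  have F: "((F_of A) has_derivative (\<lambda>a. 2 * (A x \<bullet> a))) (at x)"
    unfolding F_of_def Re_hip
    by (rule has_derivative_eq_rhs[OF has_derivative_inner[OF A' has_derivative_ident]])
      (simp add: fun_eq_iff, metis self_adjoint_inner[OF A] inner_commute)
  have "Im (hip (A x) x) = 0"
    using arg_cong[OF cnj_hip[of "A x" x], of Im] unfolding sa by (simp del: cnj_hip)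
  then have hF: "hip (A x) x = of_real (F_of A x)"
    by (simp add: complex_eq_iff F_of_def)
  have t: "0 < x \<bullet> x" using x by simp
  have "((\<lambda>y. F_of A y * f (y \<bullet> y) * (1/2)) has_derivative
    (\<lambda>a. g x (A x) a + (f1 (x \<bullet> x) - k (x \<bullet> x)) * F_of A x * (x \<bullet> a))) (at x)"
    by (rule has_derivative_eq_rhs[OF has_derivative_mult_left[OF has_derivative_mult[OF F has_derivative_radial[OF DERIV_f[OF t]]]]])
      (simp add: fun_eq_iff metric_eq[OF x] hF Re_hip algebra_simps)
  then show ?thesis by simp
qed

text \<open>
  One operator, the identity, suffices to recover \<open>k = f1\<close>.
\<close>

lemma potentials_given_by_iff:
  assumes dim: "2 \<le> cdim TYPE('v)" and T: "\<And>r. 0 < r \<Longrightarrow> T r = f (r\<^sup>2)"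
  shows "potentials_given_by g T \<longleftrightarrow> (\<forall>t>0. k t = f1 t)"
proof -
  have T': "T (norm x) = f (x \<bullet> x)" if "x \<noteq> 0" for x :: 'v
    using T[of "norm x"] that by (simp add: dot_square_norm)
  show ?thesis
  proof
    assume P: "potentials_given_by g T"
    show "\<forall>t>0. k t = f1 t"
    proof (intro allI impI)
      fix t :: real assume "0 < t"
      obtain y :: 'v where y: "norm y = sqrt t"
        using vector_choose_size[of "sqrt t"] \<open>0 < t\<close> by auto
      then have t: "y \<bullet> y = t" using \<open>0 < t\<close> by (simp add: dot_square_norm)
      have "y \<noteq> 0" using t \<open>0 < t\<close> by auto
      have "holomorphy_potential_on (- {0}) g (\<lambda>x. x) (\<lambda>y. F_of (\<lambda>x. x) y * f (y \<bullet> y) / 2)"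
        by (rule P[unfolded potentials_given_by_def, rule_format, OF self_adjoint_ident, THEN iffD2])
          (intro exI[of _ 0], simp add: T')
      then have "((\<lambda>y. F_of (\<lambda>x. x) y * f (y \<bullet> y) / 2) has_derivative g y y) (at y)"
        using \<open>y \<noteq> 0\<close> by (simp add: holomorphy_potential_on_def)
      from fun_cong[OF has_derivative_unique[OF this has_derivative_potential[OF self_adjoint_ident \<open>y \<noteq> 0\<close>]], of y]
      have "(f1 t - k t) * F_of (\<lambda>x. x) y * (y \<bullet> y) = 0"
        unfolding t by linarith
      then show "k t = f1 t" using \<open>0 < t\<close> t by (simp add: F_of_def Re_hip)
    qed
  next
    assume K: "\<forall>t>0. k t = f1 t"
    have "holomorphy_potential_on (- {0}) g A \<phi> \<longleftrightarrow>
        (\<exists>C. \<forall>x. x \<noteq> 0 \<longrightarrow> \<phi> x = F_of A x * T (norm x) / 2 + C)"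
      if A: "self_adjoint A" for A :: "'v \<Rightarrow> 'v" and \<phi>
    proof -
      define \<psi> where "\<psi> = (\<lambda>y. F_of A y * f (y \<bullet> y) / 2)"
      have \<psi>: "(\<psi> has_derivative g x (A x)) (at x)" if "x \<noteq> 0" for x
        using has_derivative_potential[OF A that] K that by (simp add: \<psi>_def)
      show ?thesis
      proof
        assume \<phi>: "holomorphy_potential_on (- {0}) g A \<phi>"
        have D: "((\<lambda>y. \<phi> y - \<psi> y) has_derivative (\<lambda>_. 0)) (at x)" if "x \<in> - {0}" for x
          using has_derivative_diff[of \<phi> "g x (A x)" "at x", OF _ \<psi>[of x]] \<phi> that
          by (auto simp: holomorphy_potential_on_def)
        have "continuous_on (- {0}) (\<lambda>y. \<phi> y - \<psi> y)"
          using D by (blast intro: continuous_at_imp_continuous_on has_derivative_continuous)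
        then have "(\<lambda>y. \<phi> y - \<psi> y) constant_on (- {0})"
          by (intro has_derivative_zero_connected_constant_on[of _ "{}"] connected_punctured dim)
            (auto simp: open_Compl intro!: has_derivative_at_withinI D)
        then obtain C where C: "\<phi> x - \<psi> x = C" if "x \<noteq> 0" for x
          unfolding constant_on_def by auto
        then show "\<exists>C. \<forall>x. x \<noteq> 0 \<longrightarrow> \<phi> x = F_of A x * T (norm x) / 2 + C"
          by (intro exI[of _ C]) (auto simp: \<psi>_def T' algebra_simps)
      next
        assume "\<exists>C. \<forall>x. x \<noteq> 0 \<longrightarrow> \<phi> x = F_of A x * T (norm x) / 2 + C"
        then obtain C where C: "\<And>x. x \<noteq> 0 \<Longrightarrow> \<phi> x = \<psi> x + C"
          by (auto simp: T' \<psi>_def)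
        have "(\<phi> has_derivative g x (A x)) (at x)" if x: "x \<noteq> 0" for x
        proof -
          have "((\<lambda>y. \<psi> y + C) has_derivative g x (A x)) (at x)"
            using has_derivative_add[OF \<psi> has_derivative_const[of C]] x by simp
          then show ?thesis
            by (rule has_derivative_transform_within_open[of _ _ _ _ "- {0}"])
              (use x C in \<open>auto simp: open_Compl\<close>)
        qed
        then show "holomorphy_potential_on (- {0}) g A \<phi>"
          by (simp add: holomorphy_potential_on_def)
      qed
    qed
    then show "potentials_given_by g T"
      unfolding potentials_given_by_def by blast
  qed
qed

end

section \<open>Real traces of complex linear and antilinear maps\<close>

text \<open>
  Up to a scalar factor, the real parts of these sums are the real traces of \<open>u \<mapsto> hip u a *\<^sub>C c\<close> and
  \<open>u \<mapsto> hip a u *\<^sub>C c\<close>. The real trace of a complex linear map is twice its complex trace; that of an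
  antilinear map vanishes, since conjugation with \<open>\<i>\<close> turns the map into its negative.
\<close>

lemma sum_hip_mult_hip:
  "(\<Sum>b\<in>Basis. hip b a * hip c b) = 2 * hip c (a::'v::hermitian_vector_space)"
  "(\<Sum>b\<in>Basis. hip a b * hip c b) = (0::complex)"
proof -
  have Imr: "Im (hip u v) = u \<bullet> (\<J> v)" for u v :: 'v
    by (simp add: Re_hip[symmetric] hip_scaleC_right)
  have e: "(\<Sum>b\<in>Basis. (b \<bullet> u) * (v \<bullet> b)) = u \<bullet> v" for u v :: 'v
    by (subst euclidean_inner[of u v]) (simp add: inner_commute)
  have e': "(\<Sum>b\<in>Basis. (u \<bullet> b) * (v \<bullet> b)) = u \<bullet> v" for u v :: 'v
    by (subst euclidean_inner[of u v]) simp
  have JJ: "(\<J> u) \<bullet> (\<J> v) = u \<bullet> v" and J: "u \<bullet> (\<J> v) = - ((\<J> u) \<bullet> v)" for u v :: 'v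
    by (simp_all add: Re_hip[symmetric] hip_scaleC_right hip_scaleC_left)
  show "(\<Sum>b\<in>Basis. hip b a * hip c b) = 2 * hip c a"
  proof (rule complex_eqI)
    have "Re (\<Sum>b\<in>Basis. hip b a * hip c b) =
        (\<Sum>b\<in>Basis. (b \<bullet> a) * (c \<bullet> b)) + (\<Sum>b\<in>Basis. (b \<bullet> \<J> a) * (\<J> c \<bullet> b))"
      unfolding Re_sum sum.distrib[symmetric]
      by (intro sum.cong refl) (simp add: Re_hip Imr J[of c])
    also have "\<dots> = 2 * (c \<bullet> a)" unfolding e JJ by (simp add: inner_commute)
    also have "\<dots> = Re (2 * hip c a)" by (simp add: Re_hip)
    finally show "Re (\<Sum>b\<in>Basis. hip b a * hip c b) = Re (2 * hip c a)" .
    have "Im (\<Sum>b\<in>Basis. hip b a * hip c b) =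
        (\<Sum>b\<in>Basis. (b \<bullet> \<J> a) * (c \<bullet> b)) - (\<Sum>b\<in>Basis. (b \<bullet> a) * (\<J> c \<bullet> b))"
      unfolding Im_sum sum_subtractf[symmetric]
      by (intro sum.cong refl) (simp add: Re_hip Imr J[of c])
    also have "\<dots> = 2 * (c \<bullet> \<J> a)" unfolding e using J[of a c] by (simp add: inner_commute)
    also have "\<dots> = Im (2 * hip c a)" by (simp add: Imr)
    finally show "Im (\<Sum>b\<in>Basis. hip b a * hip c b) = Im (2 * hip c a)" .
  qed
  show "(\<Sum>b\<in>Basis. hip a b * hip c b) = 0"
  proof (rule complex_eqI)
    have "Re (\<Sum>b\<in>Basis. hip a b * hip c b) =
        (\<Sum>b\<in>Basis. (a \<bullet> b) * (c \<bullet> b)) - (\<Sum>b\<in>Basis. (\<J> a \<bullet> b) * (\<J> c \<bullet> b))"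
      unfolding Re_sum sum_subtractf[symmetric]
      by (intro sum.cong refl) (simp add: Re_hip Imr J[of a] J[of c])
    also have "\<dots> = Re 0" unfolding e' JJ by simp
    finally show "Re (\<Sum>b\<in>Basis. hip a b * hip c b) = Re 0" .
    have "Im (\<Sum>b\<in>Basis. hip a b * hip c b) =
        - (\<Sum>b\<in>Basis. (\<J> a \<bullet> b) * (c \<bullet> b)) - (\<Sum>b\<in>Basis. (a \<bullet> b) * (\<J> c \<bullet> b))"
      unfolding Im_sum sum_subtractf[symmetric] sum_negf[symmetric]
      by (intro sum.cong refl) (simp add: Re_hip Imr J[of a] J[of c])
    also have "\<dots> = Im 0" unfolding e' using J[of c a] by (simp add: inner_commute)
    finally show "Im (\<Sum>b\<in>Basis. hip a b * hip c b) = Im 0" .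
  qed
qed

lemma op_trace_add: "op_trace (\<lambda>u. L u + M u) = op_trace L + op_trace M"
  by (simp add: op_trace_def inner_add_left sum.distrib)

lemma op_trace_complex_linear:
  fixes a w :: "'v::hermitian_vector_space"
  shows "op_trace (\<lambda>u. (c * hip u a) *\<^sub>C w) = 2 * Re (c * hip w a)"
proof -
  have "op_trace (\<lambda>u. (c * hip u a) *\<^sub>C w) = Re (c * (\<Sum>u\<in>Basis. hip u a * hip w u))"
    unfolding op_trace_def Re_hip[symmetric] sum_distrib_left Re_sum
    by (simp add: hip_scaleC_left mult.assoc)
  then show ?thesis by (simp add: sum_hip_mult_hip)
qed

lemma op_trace_antilinear:
  fixes a w :: "'v::hermitian_vector_space"
  shows "op_trace (\<lambda>u. (c * hip a u) *\<^sub>C w) = 0"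
proof -
  have "op_trace (\<lambda>u. (c * hip a u) *\<^sub>C w) = Re (c * (\<Sum>u\<in>Basis. hip a u * hip w u))"
    unfolding op_trace_def Re_hip[symmetric] sum_distrib_left Re_sum
    by (simp add: hip_scaleC_left mult.assoc)
  then show ?thesis by (simp add: sum_hip_mult_hip)
qed

lemma op_trace_scaleC: "op_trace (\<lambda>u::'v::hermitian_vector_space. c *\<^sub>C u) = real DIM('v) * Re c"
proof -
  have "(c *\<^sub>C u) \<bullet> u = Re c" if "u \<in> Basis" for u :: 'v
  proof -
    have "hip (c *\<^sub>C u) u = c"
      using that by (simp add: hip_scaleC_left hip_self)
    then show ?thesis by (metis Re_hip)
  qed
  then have "op_trace (\<lambda>u::'v. c *\<^sub>C u) = (\<Sum>u\<in>(Basis::'v set). Re c)"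
    unfolding op_trace_def by (intro sum.cong refl)
  then show ?thesis by simp
qed

section \<open>Levi-Civita connection and curvature in the Kaehler case\<close>

lemmas has_derivative_scaleC_left =
  bounded_linear.has_derivative[OF bounded_bilinear.bounded_linear_left[OF bounded_bilinear_scaleC]]

text \<open>
  Restores the two equal summands that arithmetic simplification has merged inside a scalar.
\<close>

lemma scaleC_double: "(a * (b * (2 * c))) *\<^sub>C y = (a * (b * c)) *\<^sub>C y + (a * (b * c)) *\<^sub>C y"
  unfolding cvs.scale_left_distrib[symmetric] by simp

text \<open>
  The case \<open>k = f1 = f'\<close>, with \<open>f2\<close> for \<open>f''\<close>. A third derivative of \<open>f\<close> has to exist because the curvature
  contains the derivative of the coefficient \<open>q\<close> of the connection, which involves \<open>f2\<close>.
\<close>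

locale radial_kaehler_metric =
  radial_hermitian_metric g f f1 f1 for g :: "'v::hermitian_vector_space metric_tensor" and f f1 +
  fixes f2 :: "real \<Rightarrow> real"
  assumes DERIV_f1: "0 < t \<Longrightarrow> (f1 has_real_derivative f2 t) (at t)"
    and differentiable_f2: "0 < t \<Longrightarrow> f2 differentiable (at t)"
begin

text \<open>
  The factors \<open>p\<close>, \<open>q\<close> of the Christoffel tensor solve \<open>f p = f'\<close> and
  \<open>q (f + t f') = f'' - 2 f' p\<close>, which is what the Koszul formula demands; \<open>dp\<close> is then the derivative of
  \<open>p\<close>, expressed without \<open>f\<close>.
\<close>

definition p :: "real \<Rightarrow> real" where "p t = f1 t / f t"

definition q :: "real \<Rightarrow> real" where "q t = (f2 t - 2 * f1 t * p t) / (f t + t * f1 t)"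

definition dp :: "real \<Rightarrow> real" where "dp t = (p t)\<^sup>2 + q t * (1 + p t * t)"

definition \<Gamma> :: "'v \<Rightarrow> 'v \<Rightarrow> 'v \<Rightarrow> 'v" where
  "\<Gamma> x u v = (of_real (p (x \<bullet> x)) * hip v x) *\<^sub>C u + (of_real (p (x \<bullet> x)) * hip u x) *\<^sub>C v
     + (of_real (q (x \<bullet> x)) * (hip u x * hip v x)) *\<^sub>C x"

lemma deriv_f1: "0 < t \<Longrightarrow> deriv f1 t = f2 t"
  by (rule DERIV_imp_deriv) (rule DERIV_f1)

lemma f1_eq: "x \<noteq> 0 \<Longrightarrow> f1 (x \<bullet> x) = f (x \<bullet> x) * p (x \<bullet> x)" for x :: 'v
  using f_pos[of "x \<bullet> x"] by (simp add: p_def)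

lemma f2_eq: "x \<noteq> 0 \<Longrightarrow>
    f2 (x \<bullet> x) = q (x \<bullet> x) * (f (x \<bullet> x) + (x \<bullet> x) * f1 (x \<bullet> x)) + 2 * f1 (x \<bullet> x) * p (x \<bullet> x)" for x :: 'v
  using f_plus_pos[of x] by (simp add: q_def)

lemma DERIV_p:
  assumes "x \<noteq> (0::'v)"
  shows "(p has_real_derivative dp (x \<bullet> x)) (at (x \<bullet> x))"
proof -
  have t: "0 < x \<bullet> x" using assms by simp
  have "(p has_real_derivative (f2 (x \<bullet> x) * f (x \<bullet> x) - f1 (x \<bullet> x) * f1 (x \<bullet> x)) / (f (x \<bullet> x) * f (x \<bullet> x))) (at (x \<bullet> x))"
    unfolding p_def
    by (rule DERIV_divide[OF DERIV_f1[OF t] DERIV_f[OF t]]) (use f_pos[OF t] in simp)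
  moreover have "(f2 (x \<bullet> x) * f (x \<bullet> x) - f1 (x \<bullet> x) * f1 (x \<bullet> x)) / (f (x \<bullet> x) * f (x \<bullet> x)) =
    dp (x \<bullet> x)"
    using f_pos[OF t] unfolding dp_def f2_eq[OF assms] f1_eq[OF assms]
    by (simp add: divide_simps) algebra
  ultimately show ?thesis by simp
qed

lemma DERIV_q:
  assumes "x \<noteq> (0::'v)"
  shows "(q has_real_derivative deriv q (x \<bullet> x)) (at (x \<bullet> x))"
proof -
  have t: "0 < x \<bullet> x" using assms by simp
  have "(\<lambda>t. (f2 t - 2 * f1 t * p t) / (f t + t * f1 t)) differentiable (at (x \<bullet> x))"
    using f_plus_pos[OF assms] DERIV_f[OF t] DERIV_f1[OF t] DERIV_p[OF assms] differentiable_f2[OF t]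
    by (intro differentiable_divide differentiable_diff differentiable_mult differentiable_add
      differentiable_const differentiable_ident) (auto simp: real_differentiable_def)
  then show ?thesis unfolding q_def[abs_def] by (simp add: DERIV_deriv_iff_real_differentiable)
qed

lemma christoffel_eq:
  assumes "x \<noteq> 0"
  shows "christoffel g x u v = \<Gamma> x u v"
  unfolding christoffel_def
proof (rule sharp_eqI[OF riemannian])
  fix z
  have t: "0 < x \<bullet> x" using assms by simp
  have h: "hip v u = cnj (hip u v)" "hip x u = cnj (hip u x)" "hip x v = cnj (hip v x)" "hip x z = cnj (hip z x)"
    "hip z u = cnj (hip u z)" "hip z v = cnj (hip v z)"
    by auto
  show "g x (\<Gamma> x u v) z = (frechet_derivative (\<lambda>y. g y v z) (at x) u
      + frechet_derivative (\<lambda>y. g y u z) (at x) v - frechet_derivative (\<lambda>y. g y u v) (at x) z) / 2"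
    unfolding frechet_derivative_metric[OF assms] metric_eq[OF assms] \<Gamma>_def deriv_f1[OF t] inner_eq_Re_hip[of x u] 
     inner_eq_Re_hip[of x v] inner_eq_Re_hip[of x z] hip_add_left hip_scaleC_left hip_self f2_eq[OF assms] f1_eq[OF assms] h
    unfolding complex_mult_cnj times_complex.simps plus_complex.simps cnj.simps Re_complex_of_real Im_complex_of_real
    by (simp add: field_simps)
qed (use assms in auto)

lemma has_derivative_\<Gamma>:
  assumes "x \<noteq> 0"
  defines "t \<equiv> x \<bullet> x"
  defines "p' \<equiv> dp t"
  shows "((\<lambda>y. \<Gamma> y v w) has_derivative (\<lambda>u.
      (of_real p' * (hip u x + hip x u) * hip w x + of_real (p t) * hip w u) *\<^sub>C v
    + (of_real p' * (hip u x + hip x u) * hip v x + of_real (p t) * hip v u) *\<^sub>C w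
    + (of_real (deriv q t) * (hip u x + hip x u) * hip v x * hip w x
        + of_real (q t) * (hip v u * hip w x + hip v x * hip w u)) *\<^sub>C x
    + (of_real (q t) * (hip v x * hip w x)) *\<^sub>C u)) (at x)"
proof -
  \<comment> \<open>The derivative of \<open>x \<bullet> x\<close>, split into its parts that are linear and antilinear in \<open>u\<close>.\<close>
  have s: "complex_of_real (2 * c * (x \<bullet> u)) = of_real c * (hip u x + hip x u)" for c u
  proof -
    have h: "hip x u = cnj (hip u x)" by simp
    show ?thesis
      unfolding h inner_eq_Re_hip by (simp add: complex_eq_iff del: cnj_hip)
  qed
  have P: "((\<lambda>y. complex_of_real (p (y \<bullet> y))) has_derivative (\<lambda>u. of_real p' * (hip u x + hip x u))) (at x)"
    unfolding s[symmetric] using has_derivative_radial[OF DERIV_p[OF assms(1)]] unfolding p'_def t_def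
    by (rule has_derivative_of_real)
  have Q: "((\<lambda>y. complex_of_real (q (y \<bullet> y))) has_derivative (\<lambda>u. of_real (deriv q t) * (hip u x + hip x u))) (at x)"
    unfolding s[symmetric] using has_derivative_radial[OF DERIV_q[OF assms(1)]] unfolding p'_def t_def
    by (rule has_derivative_of_real)
  have H: "((\<lambda>y. hip a y) has_derivative hip a) (at x)" for a
    by (intro bounded_linear_imp_has_derivative bounded_bilinear.bounded_linear_right[OF bounded_bilinear_hip])
  have "((\<lambda>y. \<Gamma> y v w) has_derivative (\<lambda>u.
      (of_real (p t) * hip w u + of_real p' * (hip u x + hip x u) * hip w x) *\<^sub>C v
    + (of_real (p t) * hip v u + of_real p' * (hip u x + hip x u) * hip v x) *\<^sub>C w
    + ((of_real (q t) * (hip v x * hip w x)) *\<^sub>C u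
    + (of_real (q t) * (hip v x * hip w u + hip v u * hip w x)
        + of_real (deriv q t) * (hip u x + hip x u) * (hip v x * hip w x)) *\<^sub>C x))) (at x)"
    unfolding \<Gamma>_def t_def
    by (rule has_derivative_add[OF has_derivative_add[OF has_derivative_scaleC_left[OF has_derivative_mult[OF P H]]
          has_derivative_scaleC_left[OF has_derivative_mult[OF P H]]]
        has_derivative_scaleC[OF has_derivative_mult[OF Q has_derivative_mult[OF H H]] has_derivative_ident], unfolded t_def])
  then show ?thesis
    by (rule has_derivative_eq_rhs) (simp add: fun_eq_iff add_ac mult_ac)
qed

lemma levi_civita_const: "x \<noteq> 0 \<Longrightarrow> levi_civita g (\<lambda>_. v) (\<lambda>_. w) x = \<Gamma> x v w"
  by (simp add: levi_civita_def christoffel_eq)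

lemma levi_civita_twice:
  assumes "x \<noteq> 0"
  shows "levi_civita g (\<lambda>_. u) (levi_civita g (\<lambda>_. v) (\<lambda>_. w)) x =
    frechet_derivative (\<lambda>y. \<Gamma> y v w) (at x) u + \<Gamma> x u (\<Gamma> x v w)"
proof -
  have "frechet_derivative (levi_civita g (\<lambda>_. v) (\<lambda>_. w)) (at x) = frechet_derivative (\<lambda>y. \<Gamma> y v w) (at x)"
    by (rule frechet_derivative_transform_open[of "- {0}"]) (use assms in \<open>auto simp: open_Compl levi_civita_const\<close>)
  then show ?thesis
    unfolding levi_civita_def[of g "\<lambda>_. u"] christoffel_eq[OF assms] levi_civita_const[OF assms] by simp
qed

text \<open>
  Since \<open>\<Gamma>\<close> is complex bilinear, the terms \<open>\<partial>\<Gamma> + \<Gamma>\<Gamma>\<close> built without conjugates of \<open>u\<close>, \<open>v\<close> cancel after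
  antisymmetrisation, and the antilinear part of the derivative of \<open>\<Gamma>\<close> remains. Each summand is
  complex linear or antilinear in \<open>u\<close>, ready for taking the trace.
\<close>

lemma curvature_eq:
  assumes "x \<noteq> 0"
  defines "t \<equiv> x \<bullet> x"
  defines "p' \<equiv> dp t"
  shows "curvature g x u v w =
      (of_real p' * hip v x * hip x u) *\<^sub>C w
    + (of_real (p t) * hip v u) *\<^sub>C w
    + (of_real p' * hip w x * hip x u) *\<^sub>C v
    + (of_real (p t) * hip w u) *\<^sub>C v
    + (of_real (deriv q t) * hip v x * hip w x * hip x u) *\<^sub>C x
    + (of_real (q t) * hip w x * hip v u) *\<^sub>C x
    + (of_real (q t) * hip v x * hip w u) *\<^sub>C x
    + ((- of_real p' * hip x v) * hip u x) *\<^sub>C w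
    + ((- of_real (p t)) * hip u v) *\<^sub>C w
    + (- of_real p' * hip x v * hip w x - of_real (p t) * hip w v) *\<^sub>C u
    + ((- of_real (deriv q t) * hip x v * hip w x) * hip u x) *\<^sub>C x
    + ((- of_real (q t) * hip w x) * hip u v) *\<^sub>C x
    + ((- of_real (q t) * hip w v) * hip u x) *\<^sub>C x"
  unfolding curvature_def levi_civita_twice[OF assms(1)]
    frechet_derivative_at[OF has_derivative_\<Gamma>[OF assms(1)], symmetric]
  unfolding p'_def dp_def t_def \<Gamma>_def
  \<comment> \<open>The value of \<^const>\<open>dp\<close> is exactly what cancels the terms without a conjugate.\<close>
  by (simp add: hip_add_left hip_scaleC_left hip_self algebra_simps power2_eq_square)
    (simp only: scaleC_double add_ac)

end

section \<open>Ricci tensor, scalar curvature and the SKR property\<close>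

context radial_kaehler_metric
begin

text \<open>
  The coefficients of the Ricci tensor with respect to the two forms \<open>Re\<langle>v,w\<rangle>\<close> and
  \<open>Re(\<langle>v,x\<rangle>\<langle>x,w\<rangle>)\<close> of which the metric is composed. The real dimension enters through the trace of the identity.
\<close>

definition ric1 :: "real \<Rightarrow> real" where
  "ric1 t = - ((2 + real DIM('v)) * p t + 2 * t * q t)"

definition ric2 :: "real \<Rightarrow> real" where
  "ric2 t = - ((2 + real DIM('v)) * dp t + 2 * t * deriv q t + 2 * q t)"

lemma ricci_eq:
  assumes "x \<noteq> 0"
  shows "ricci g x v w = ric1 (x \<bullet> x) * Re (hip v w) + ric2 (x \<bullet> x) * Re (hip v x * hip x w)"
proof -
  have h: "hip w v = cnj (hip v w)" "hip x v = cnj (hip v x)" "hip w x = cnj (hip x w)"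
    by auto
  show ?thesis
    unfolding ricci_def curvature_eq[OF assms] op_trace_add
      op_trace_antilinear op_trace_complex_linear op_trace_scaleC hip_self h
    by (simp add: ric1_def ric2_def algebra_simps del: cnj_hip)
qed

text \<open>
  Raising an index solves \<open>ric1 = f ric1_op\<close> and \<open>ric2 = f1 ric1_op + (f + t f1) ric2_op\<close>.
\<close>

definition ric1_op :: "real \<Rightarrow> real" where "ric1_op t = ric1 t / f t"

definition ric2_op :: "real \<Rightarrow> real" where
  "ric2_op t = (ric2 t - f1 t * ric1_op t) / (f t + t * f1 t)"

lemma ricci_op_eq:
  assumes "x \<noteq> 0"
  shows "ricci_op g x v = of_real (ric1_op (x \<bullet> x)) *\<^sub>C v + (of_real (ric2_op (x \<bullet> x)) * hip v x) *\<^sub>C x"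
  unfolding ricci_op_def
proof (rule sharp_eqI[OF riemannian])
  fix z
  let ?t = "x \<bullet> x"
  have t: "0 < x \<bullet> x" using assms by simp
  have 1: "ric1 ?t = f ?t * ric1_op ?t"
    using f_pos[OF t] by (simp add: ric1_op_def)
  have 2: "ric2 ?t = (f ?t + ?t * f1 ?t) * ric2_op ?t + f1 ?t * ric1_op ?t"
    using f_plus_pos[OF assms] by (simp add: ric2_op_def)
  show "g x (of_real (ric1_op ?t) *\<^sub>C v + (of_real (ric2_op ?t) * hip v x) *\<^sub>C x) z = ricci g x v z"
    unfolding ricci_eq[OF assms] metric_eq[OF assms] 1 2 hip_add_left hip_scaleC_left hip_self
    by (simp add: algebra_simps)
qed (use assms in auto)

lemma scalar_curvature_eq:
  assumes "x \<noteq> 0"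
  shows "scalar_curvature g x = real DIM('v) * ric1_op (x \<bullet> x) + 2 * (x \<bullet> x) * ric2_op (x \<bullet> x)"
  unfolding scalar_curvature_def ricci_op_eq[OF assms, abs_def]
    op_trace_add op_trace_complex_linear op_trace_scaleC hip_self by simp

definition \<tau> :: "'v \<Rightarrow> real" where "\<tau> x = (x \<bullet> x) * f (x \<bullet> x) / 2"

lemma has_derivative_\<tau>:
  assumes "x \<noteq> 0"
  shows "(\<tau> has_derivative g x x) (at x)"
  using has_derivative_potential[OF self_adjoint_ident assms]
  by (simp add: \<tau>_def[abs_def] F_of_def Re_hip)

lemma gradient_\<tau>: "x \<noteq> 0 \<Longrightarrow> gradient g \<tau> x = x"
  unfolding gradient_def frechet_derivative_at[OF has_derivative_\<tau>, symmetric]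
  by (rule sharp_eqI[OF riemannian]) auto

text \<open>
  The differential of \<open>\<tau>\<close> is \<open>g(x,\<cdot>)\<close>, whose components are sums of products of linear functions and the
  smooth components of \<open>g\<close>.
\<close>

lemma smooth_on_\<tau>: "smooth_on (- {0}) \<tau>"
  unfolding smooth_on_def
proof
  fix n
  have U: "open (- {0::'v})" by (simp add: open_Compl)
  show "higher_differentiable_on (- {0}) \<tau> n"
  proof (cases n)
    case 0
    have "continuous_on (- {0}) \<tau>"
      using has_derivative_\<tau> by (auto intro!: continuous_at_imp_continuous_on intro: has_derivative_continuous)
    with 0 show ?thesis by simp
  next
    case (Suc m)
    have "higher_differentiable_on (- {0}) (\<lambda>x. frechet_derivative \<tau> (at x) v) m" for v
    proof -
      have E: "frechet_derivative \<tau> (at x) v = (\<Sum>b\<in>Basis. (x \<bullet> b) * g x b v)" if "x \<in> - {0}" for x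
      proof -
        have L: "linear (\<lambda>u. g x u v)"
          using riemannian that by (auto simp: riemannian_metric_on_def bilinear_def)
        then have "g x (\<Sum>b\<in>Basis. (x \<bullet> b) *\<^sub>R b) v = (\<Sum>b\<in>Basis. (x \<bullet> b) * g x b v)"
          using linear_sum[OF L, of "\<lambda>b. (x \<bullet> b) *\<^sub>R b" Basis] linear_scale[OF L] by simp
        then show ?thesis
          using that by (simp add: euclidean_representation frechet_derivative_at[OF has_derivative_\<tau>, symmetric])
      qed
      have "higher_differentiable_on (- {0}) (\<lambda>x. \<Sum>b\<in>Basis. (x \<bullet> b) * g x b v) m"
      proof (intro higher_differentiable_on_sum higher_differentiable_on_mult U finite_Basis)
        fix b :: 'v
        show "higher_differentiable_on (- {0}) (\<lambda>x. x \<bullet> b) m"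
          by (intro higher_differentiable_on_bounded_linear bounded_linear_inner_left)
        show "higher_differentiable_on (- {0}) (\<lambda>x. g x b v) m"
          using riemannian by (auto simp: riemannian_metric_on_def smooth_on_def)
      qed
      then show ?thesis
        by (rule higher_differentiable_on_cong[OF U, THEN iffD2, rotated]) (rule E)
    qed
    then show ?thesis
      using Suc has_derivative_\<tau> by (auto intro: differentiableI)
  qed
qed

text \<open>
  The flow of \<open>J\<nabla>\<tau>\<close> consists of multiplications by unit complex numbers, which are isometries.
\<close>

lemma killing_potential_\<tau>: "killing_potential_on (- {0}) g \<tau>"
  unfolding killing_potential_on_def killing_field_on_def
proof (intro conjI ballI allI smooth_on_\<tau>)
  have U: "open (- {0::'v})" by (simp add: open_Compl)
  have J: "bounded_linear (\<lambda>x::'v. \<J> x)"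
    by (rule bounded_bilinear.bounded_linear_right[OF bounded_bilinear_scaleC])
  show "smooth_on (- {0}) (\<lambda>x. \<J> (gradient g \<tau> x))"
    unfolding smooth_on_def
  proof
    fix n
    show "higher_differentiable_on (- {0}) (\<lambda>x. \<J> (gradient g \<tau> x)) n"
      by (subst higher_differentiable_on_cong[OF U, of _ "\<lambda>x. \<J> x"])
        (simp_all add: gradient_\<tau> higher_differentiable_on_bounded_linear[OF J])
  qed
  fix x u v :: 'v
  assume "x \<in> - {0}"
  then have x: "x \<noteq> 0" by simp
  have "((\<lambda>x. \<J> (gradient g \<tau> x)) has_derivative (\<lambda>x. \<J> x)) (at x)"
    by (rule has_derivative_transform_within_open[OF bounded_linear_imp_has_derivative[OF J] U])
      (use x in \<open>auto simp: gradient_\<tau>\<close>)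
  note D = frechet_derivative_at[OF this, symmetric]
  have "x \<bullet> \<J> x = 0"
    using inner_eq_Re_hip[of x "\<J> x"] by (simp add: hip_scaleC_left hip_self)
  then show "frechet_derivative (\<lambda>y. g y u v) (at x) (\<J> (gradient g \<tau> x))
        + g x (frechet_derivative (\<lambda>x. \<J> (gradient g \<tau> x)) (at x) u) v
        + g x u (frechet_derivative (\<lambda>x. \<J> (gradient g \<tau> x)) (at x) v) = 0"
    unfolding D gradient_\<tau>[OF x] frechet_derivative_metric[OF x] metric_eq[OF x]
    by (simp add: hip_scaleC_left hip_scaleC_right algebra_simps)
qed

lemma hessian_op_\<tau>:
  assumes "x \<noteq> 0"
  shows "hessian_op g \<tau> x v = v + \<Gamma> x v x"
proof -
  have "frechet_derivative (gradient g \<tau>) (at x) = frechet_derivative (\<lambda>y. y) (at x)"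
    by (rule frechet_derivative_transform_open[of "- {0}"])
      (use assms in \<open>auto simp: open_Compl gradient_\<tau>\<close>)
  then show ?thesis
    by (simp add: hessian_op_def levi_civita_def christoffel_eq[OF assms] gradient_\<tau>[OF assms])
qed

text \<open>
  On a vector \<open>w\<close> with \<open>\<langle>w,x\<rangle> = 0\<close> all terms of the Ricci operator and of the Hessian that are
  proportional to \<open>x\<close> disappear.
\<close>

lemma SKR_metric:
  assumes "2 \<le> cdim TYPE('v)"
  shows "SKR_metric_on (- {0}) g"
  unfolding SKR_metric_on_def
proof (intro conjI exI[of _ \<tau>] ballI impI allI)
  show "kaehler_metric_on (- {0}) g" using kaehler_iff[OF assms] by blast
  show "killing_potential_on (- {0}) g \<tau>" by (rule killing_potential_\<tau>)
  show "\<not> \<tau> constant_on - {0}"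
  proof
    assume "\<tau> constant_on - {0}"
    then obtain c where c: "\<And>x. x \<in> - {0} \<Longrightarrow> \<tau> x = c" unfolding constant_on_def by blast
    obtain x :: 'v where x: "x \<noteq> 0"
      using nonempty_Basis nonzero_Basis by blast
    have "(\<tau> has_derivative (\<lambda>_. 0)) (at x)"
      by (rule has_derivative_transform_within_open[OF has_derivative_const, of "- {0}" x c])
        (use x c in \<open>auto simp: open_Compl\<close>)
    from has_derivative_unique[OF this has_derivative_\<tau>[OF x]] have "g x x x = 0" by metis
    moreover have "0 < g x x x" using riemannian x by (auto simp: riemannian_metric_on_def)
    ultimately show False by simp
  qed
  fix x w :: 'v
  assume "x \<in> - {0}" and w: "w \<noteq> 0 \<and> (\<forall>c. g x w (c *\<^sub>C gradient g \<tau> x) = 0)"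
  then have x: "x \<noteq> 0" by simp
  have "(f (x \<bullet> x) + (x \<bullet> x) * f1 (x \<bullet> x)) * (cmod (hip w x))\<^sup>2 = g x w (hip w x *\<^sub>C x)"
    unfolding metric_eq[OF x] cmod_power2
    by (simp add: hip_scaleC_right hip_self power2_eq_square algebra_simps del: cnj_hip)
  also have "\<dots> = 0" using w x by (simp add: gradient_\<tau>)
  finally have h: "hip w x = 0" using f_plus_pos[OF x] by simp
  show "is_eigenvector (ricci_op g x) w"
    using w h by (auto simp: is_eigenvector_def ricci_op_eq[OF x] scaleC_of_real)
  have "hessian_op g \<tau> x w = (1 + p (x \<bullet> x) * (x \<bullet> x)) *\<^sub>R w"
    using h by (simp add: hessian_op_\<tau>[OF x] \<Gamma>_def hip_self scaleC_of_real[symmetric] scaleC_add_left)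
  then show "is_eigenvector (hessian_op g \<tau> x) w"
    using w by (auto simp: is_eigenvector_def)
qed

end

section \<open>Functionally dependent quadratic forms\<close>

text \<open>
  Polarisation at the pair \<open>x\<close>, \<open>A x\<close>.
\<close>

lemma symmetric_zero_if_quadratic_form_zero:
  fixes A :: "'a::real_inner \<Rightarrow> 'a"
  assumes A: "linear A" "\<And>x y. A x \<bullet> y = x \<bullet> A y" and zero: "\<And>x. norm x = 1 \<Longrightarrow> A x \<bullet> x = 0"
  shows "A x = 0"
proof -
  have q: "A z \<bullet> z = 0" for z
  proof (cases "z = 0")
    case False
    define y where "y = z /\<^sub>R norm z"
    have y: "norm y = 1" and z: "z = norm z *\<^sub>R y" using False by (simp_all add: y_def)
    show ?thesis by (subst (1 2) z) (simp add: linear_scale[OF A(1)] zero[OF y])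
  qed simp
  have "A (x + A x) \<bullet> (x + A x) = 2 * (A x \<bullet> A x)"
    using A q by (simp add: linear_add inner_add_left inner_add_right inner_commute)
  with q show ?thesis by simp
qed

lemma quadratic_form_combination:
  fixes A :: "'a::real_inner \<Rightarrow> 'a"
  assumes "linear A" "\<And>x y. A x \<bullet> y = x \<bullet> A y"
  shows "A (c *\<^sub>R e + s *\<^sub>R w) \<bullet> (c *\<^sub>R e + s *\<^sub>R w) =
    c\<^sup>2 * (A e \<bullet> e) + 2 * c * s * (A e \<bullet> w) + s\<^sup>2 * (A w \<bullet> w)"
  using assms(2)[of w e] inner_commute[of w "A e"] assms(1)
  by (simp add: linear_add linear_scale inner_add_left inner_add_right power2_eq_square algebra_simps)

lemma norm_combination:
  fixes e w :: "'a::real_inner"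
  assumes "norm e = 1" "norm w = 1" "e \<bullet> w = 0" "c\<^sup>2 + s\<^sup>2 = 1"
  shows "norm (c *\<^sub>R e + s *\<^sub>R w) = 1"
  using assms by (simp add: norm_eq_1 inner_add_left inner_add_right inner_commute power2_eq_square)

lemma quadratic_form_great_circle_derivative:
  fixes A :: "'a::real_inner \<Rightarrow> 'a"
  assumes "linear A" "\<And>x y. A x \<bullet> y = x \<bullet> A y"
  shows "((\<lambda>\<theta>. A (cos \<theta> *\<^sub>R e + sin \<theta> *\<^sub>R w) \<bullet> (cos \<theta> *\<^sub>R e + sin \<theta> *\<^sub>R w))
    has_real_derivative 2 * (A e \<bullet> w)) (at 0)"
  unfolding quadratic_form_combination[OF assms]
  by (auto intro!: derivative_eq_intros)

text \<open>
  The component of \<open>A e\<close> orthogonal to \<open>e\<close> would, after normalisation, be a forbidden \<open>w\<close>.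
\<close>

lemma eigenvector_if_orthogonal_to_complement:
  fixes A :: "'a::real_inner \<Rightarrow> 'a"
  assumes "norm e = 1" "\<And>w. norm w = 1 \<Longrightarrow> e \<bullet> w = 0 \<Longrightarrow> A e \<bullet> w = 0"
  shows "A e = (A e \<bullet> e) *\<^sub>R e"
proof (rule ccontr)
  define d where "d = A e - (A e \<bullet> e) *\<^sub>R e"
  assume "A e \<noteq> (A e \<bullet> e) *\<^sub>R e"
  then have "d \<noteq> 0" by (simp add: d_def)
  have ee: "e \<bullet> e = 1" using assms(1) by (simp add: norm_eq_1)
  have ed: "e \<bullet> d = 0" by (simp add: d_def inner_diff_right ee inner_commute)
  then have "A e \<bullet> (d /\<^sub>R norm d) = 0"
    using \<open>d \<noteq> 0\<close> by (intro assms(2)) auto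
  then have "A e \<bullet> d = 0" using \<open>d \<noteq> 0\<close> by simp
  then have "d \<bullet> d = 0" using ed by (subst (1) d_def) (simp add: inner_diff_left)
  with \<open>d \<noteq> 0\<close> show False by simp
qed

text \<open>
  The derivative of the quadratic form at \<open>e\<close> along the great circle in the direction \<open>w\<close> is
  \<open>2 (A e \<bullet> w)\<close>.
\<close>

lemma rayleigh_max_critical:
  fixes A :: "'a::real_inner \<Rightarrow> 'a"
  assumes A: "linear A" "\<And>x y. A x \<bullet> y = x \<bullet> A y"
    and e: "norm e = 1" "\<And>x. norm x = 1 \<Longrightarrow> A x \<bullet> x \<le> A e \<bullet> e"
    and w: "norm w = 1" "e \<bullet> w = 0"
  shows "A e \<bullet> w = 0"
proof -
  have "2 * (A e \<bullet> w) = 0"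
    by (rule DERIV_local_max[OF quadratic_form_great_circle_derivative[OF A], of 1])
      (auto intro!: e(2) norm_combination e(1) w)
  then show ?thesis by simp
qed

text \<open>
  The Rayleigh quotient attains its extremes on the compact unit sphere, and critical points are
  eigenvectors.
\<close>

lemma rayleigh_extremes:
  fixes A :: "'a::euclidean_space \<Rightarrow> 'a"
  assumes A: "linear A" "\<And>x y. A x \<bullet> y = x \<bullet> A y"
  obtains e e' l u where "norm e = 1" "norm e' = 1" "A e = u *\<^sub>R e" "A e' = l *\<^sub>R e'"
    "\<And>x. norm x = 1 \<Longrightarrow> l \<le> A x \<bullet> x \<and> A x \<bullet> x \<le> u"
proof -
  obtain b :: 'a where b: "b \<in> Basis" using nonempty_Basis by blast
  then have ne: "sphere (0::'a) 1 \<noteq> {}" by (auto intro!: exI[of _ b])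
  have cont: "continuous_on (sphere 0 1) (\<lambda>x. A x \<bullet> x)"
    using A(1) by (intro continuous_on_inner continuous_on_id linear_continuous_on)
      (simp add: linear_conv_bounded_linear)
  obtain e where e: "norm e = 1" "\<And>x. norm x = 1 \<Longrightarrow> A x \<bullet> x \<le> A e \<bullet> e"
    using continuous_attains_sup[OF compact_sphere ne cont] by auto
  obtain e' where e': "norm e' = 1" "\<And>x. norm x = 1 \<Longrightarrow> A e' \<bullet> e' \<le> A x \<bullet> x"
    using continuous_attains_inf[OF compact_sphere ne cont] by auto
  have "A e \<bullet> w = 0" if "norm w = 1" "e \<bullet> w = 0" for w
    using rayleigh_max_critical[OF A e(1) _ that] e(2) by blast
  then have "A e = (A e \<bullet> e) *\<^sub>R e"
    by (intro eigenvector_if_orthogonal_to_complement e(1))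
  moreover have "A e' \<bullet> w = 0" if "norm w = 1" "e' \<bullet> w = 0" for w
    using rayleigh_max_critical[of "\<lambda>x. - A x" e' w] A e' that
    by (simp add: linear_compose_neg)
  then have "A e' = (A e' \<bullet> e') *\<^sub>R e'"
    by (intro eigenvector_if_orthogonal_to_complement e'(1))
  ultimately show thesis using that[of e e' "A e \<bullet> e" "A e' \<bullet> e'"] e e' by blast
qed

text \<open>
  A critical point of the first form on the sphere is critical for the second one, by the chain rule. At
  extremal eigenvectors \<open>e\<close>, \<open>e'\<close> of \<open>A\<close> this kills the mixed term \<open>B e \<bullet> e'\<close>, so that both forms are affine in
  \<open>cos\<^sup>2 \<theta>\<close> on the great circle through \<open>e\<close> and \<open>e'\<close>. That circle already realises every value of the first form,
  hence \<open>\<psi>\<close> is affine there, and the affine relation holds on the whole sphere.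
\<close>

lemma quadratic_forms_dependent:
  fixes A B :: "'a::euclidean_space \<Rightarrow> 'a" and \<psi> :: "real \<Rightarrow> real"
  assumes A: "linear A" "\<And>x y. A x \<bullet> y = x \<bullet> A y"
    and B: "linear B" "\<And>x y. B x \<bullet> y = x \<bullet> B y"
    and dep: "\<And>x. norm x = 1 \<Longrightarrow> B x \<bullet> x = \<psi> (A x \<bullet> x)"
    and diff: "\<And>x. norm x = 1 \<Longrightarrow> \<psi> differentiable (at (A x \<bullet> x))"
  obtains a b l u where "\<And>x. norm x = 1 \<Longrightarrow> l \<le> A x \<bullet> x \<and> A x \<bullet> x \<le> u"
    "\<And>\<mu>. l \<le> \<mu> \<Longrightarrow> \<mu> \<le> u \<Longrightarrow> \<exists>x. norm x = 1 \<and> A x \<bullet> x = \<mu>"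
    "\<And>x. B x = a *\<^sub>R A x + b *\<^sub>R x"
proof -
  obtain e e' l u where e: "norm e = 1" "A e = u *\<^sub>R e" and e': "norm e' = 1" "A e' = l *\<^sub>R e'"
    and lu: "\<And>x. norm x = 1 \<Longrightarrow> l \<le> A x \<bullet> x \<and> A x \<bullet> x \<le> u"
    by (rule rayleigh_extremes[OF A]) blast
  have ee: "A e \<bullet> e = u" "A e' \<bullet> e' = l"
    using e e' by (simp_all add: dot_square_norm)
  have "\<exists>a b. (\<forall>x. norm x = 1 \<longrightarrow> B x \<bullet> x = a * (A x \<bullet> x) + b) \<and>
      (\<forall>\<mu>. l \<le> \<mu> \<longrightarrow> \<mu> \<le> u \<longrightarrow> (\<exists>x. norm x = 1 \<and> A x \<bullet> x = \<mu>))"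
  proof (cases "l < u")
    case False
    then have "A x \<bullet> x = u" if "norm x = 1" for x
      using lu[OF that] by linarith
    moreover have "l = u" using lu[OF e(1)] False by linarith
    ultimately show ?thesis
      using dep e(1) ee by (intro exI[of _ 0] exI[of _ "\<psi> u"]) auto
  next
    case True
    have "u * (e \<bullet> e') = l * (e \<bullet> e')"
      using A(2)[of e e'] e(2) e'(2) by simp
    then have orth: "e \<bullet> e' = 0" using True by simp
    then have Aee: "A e \<bullet> e' = 0" using e(2) by simp
    have Bee: "B e \<bullet> e' = 0"
    proof -
      let ?c = "\<lambda>\<theta>. cos \<theta> *\<^sub>R e + sin \<theta> *\<^sub>R e'"
      obtain D where D: "(\<psi> has_real_derivative D) (at (A e \<bullet> e))"
        using diff[OF e(1)] by (auto simp: real_differentiable_def)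
      have "((\<lambda>\<theta>. A (?c \<theta>) \<bullet> ?c \<theta>) has_real_derivative 0) (at 0)"
        using quadratic_form_great_circle_derivative[OF A, of e e'] Aee by simp
      then have "((\<lambda>\<theta>. \<psi> (A (?c \<theta>) \<bullet> ?c \<theta>)) has_real_derivative D * 0) (at 0)"
        using D by (intro DERIV_chain2[of \<psi>]) simp_all
      moreover have "\<psi> (A (?c \<theta>) \<bullet> ?c \<theta>) = B (?c \<theta>) \<bullet> ?c \<theta>" for \<theta>
        by (intro dep[symmetric] norm_combination e e' orth) simp
      ultimately have "2 * (B e \<bullet> e') = D * 0"
        using DERIV_unique[OF quadratic_form_great_circle_derivative[OF B, of e e']] by simp
      then show ?thesis by simp
    qed
    have circle: "\<exists>x. norm x = 1 \<and> A x \<bullet> x = \<mu> \<and>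
        B x \<bullet> x = (\<mu> - l) / (u - l) * (B e \<bullet> e) + (u - \<mu>) / (u - l) * (B e' \<bullet> e')"
      if \<mu>: "l \<le> \<mu>" "\<mu> \<le> u" for \<mu>
    proof -
      define c s where "c = sqrt ((\<mu> - l) / (u - l))" and "s = sqrt ((u - \<mu>) / (u - l))"
      have c2: "c\<^sup>2 = (\<mu> - l) / (u - l)" "s\<^sup>2 = (u - \<mu>) / (u - l)"
        using \<mu> True by (simp_all add: c_def s_def)
      have one: "c\<^sup>2 + s\<^sup>2 = 1"
        unfolding c2 using True by (simp add: add_divide_distrib[symmetric])
      have "c\<^sup>2 * u + s\<^sup>2 * l = \<mu>"
        unfolding c2 using True by (simp add: divide_simps) algebra
      then show ?thesis
        using norm_combination[OF e(1) e'(1) orth one]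
        by (intro exI[of _ "c *\<^sub>R e + s *\<^sub>R e'"])
          (simp add: quadratic_form_combination[OF A] quadratic_form_combination[OF B] Aee Bee ee c2)
    qed
    have "B x \<bullet> x = (B e \<bullet> e - B e' \<bullet> e') / (u - l) * (A x \<bullet> x) + (u * (B e' \<bullet> e') - l * (B e \<bullet> e)) / (u - l)"
      if x: "norm x = 1" for x
    proof -
      obtain y where y: "norm y = 1" "A y \<bullet> y = A x \<bullet> x" and
        By: "B y \<bullet> y = (A x \<bullet> x - l) / (u - l) * (B e \<bullet> e) + (u - A x \<bullet> x) / (u - l) * (B e' \<bullet> e')"
        using circle[of "A x \<bullet> x"] lu[OF x] by blast
      have "B x \<bullet> x = B y \<bullet> y" using dep[OF x] dep[OF y(1)] y(2) by simp
      then show ?thesis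
        unfolding By using True by (simp add: divide_simps) (simp add: algebra_simps)
    qed
    then show ?thesis using circle by blast
  qed
  then obtain a b where ab: "\<And>x. norm x = 1 \<Longrightarrow> B x \<bullet> x = a * (A x \<bullet> x) + b"
    and range: "\<And>\<mu>. l \<le> \<mu> \<Longrightarrow> \<mu> \<le> u \<Longrightarrow> \<exists>x. norm x = 1 \<and> A x \<bullet> x = \<mu>"
    by blast
  define M where "M = (\<lambda>x. B x - (a *\<^sub>R A x + b *\<^sub>R x))"
  have "M x = 0" for x
  proof (rule symmetric_zero_if_quadratic_form_zero[of M])
    show M: "linear M" unfolding M_def
      by (intro linear_compose_sub linear_compose_add linear_compose_scale_right A B linear_id[unfolded id_def])
    show "M x \<bullet> y = x \<bullet> M y" for x y
      using A(2)[of x y] B(2)[of x y]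
      by (simp add: M_def inner_diff_left inner_diff_right inner_add_left inner_add_right)
    show "M x \<bullet> x = 0" if "norm x = 1" for x
      using ab[OF that] that by (simp add: M_def inner_diff_left inner_add_left dot_square_norm)
  qed
  then have "B x = a *\<^sub>R A x + b *\<^sub>R x" for x by (simp add: M_def)
  with lu range that show thesis by blast
qed

section \<open>Separation of the radial and the spherical variable\<close>

text \<open>
  The arguments \<open>y = C + \<mu> \<tau>(r)\<close> and \<open>z = C + \<nu> \<tau>(r)\<close> with \<open>\<mu>\<close>, \<open>\<nu>\<close> strictly between \<open>l\<close> and \<open>u\<close> also occur for
  radii \<open>s \<noteq> r\<close> close to \<open>r\<close>. Cross-multiplication eliminates \<open>q\<close> at both radii, and the difference of
  the two relations is \<open>b (\<tau>(s) - \<tau>(r)) (h y - h z) = 0\<close>. So \<open>h\<close> is constant on the open interval belonging to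
  each radius; nearby intervals overlap, and the endpoints follow by continuity.
\<close>

lemma separated_affine_function_constant:
  fixes \<tau> q h :: "real \<Rightarrow> real"
  assumes cont: "continuous_on {0<..} \<tau>" and pos: "\<And>r. 0 < r \<Longrightarrow> 0 < \<tau> r"
    and mono: "\<And>r s. 0 < r \<Longrightarrow> r < s \<Longrightarrow> \<tau> r < \<tau> s"
    and lu: "l < u" and b: "b \<noteq> 0"
    and eq: "\<And>r \<mu>. 0 < r \<Longrightarrow> l \<le> \<mu> \<Longrightarrow> \<mu> \<le> u \<Longrightarrow>
      a * (\<mu> * \<tau> r) + b * \<tau> r + c = q r * h (C + \<mu> * \<tau> r)"
    and cont_h: "\<And>r \<mu>. 0 < r \<Longrightarrow> l \<le> \<mu> \<Longrightarrow> \<mu> \<le> u \<Longrightarrow> isCont h (C + \<mu> * \<tau> r)"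
  shows "\<exists>K. \<forall>r>0. \<forall>\<mu>\<in>{l..u}. h (C + \<mu> * \<tau> r) = K"
proof -
  have at_within: "at r within {0<..} = at r" if "0 < r" for r :: real
    using that by (intro at_within_open) auto
  have lim: "(\<tau> \<longlongrightarrow> \<tau> r) (at r)" if "0 < r" for r
    using cont that at_within[OF that] by (metis continuous_on_def greaterThan_iff)
  have ev_pos: "\<forall>\<^sub>F s in at r. 0 < s" if "0 < r" for r :: real
    using that order_tendstoD(1)[OF tendsto_ident_at] by blast
  have inner: "h (C + \<mu> * \<tau> r) = h (C + \<nu> * \<tau> r)"
    if r: "0 < r" and \<mu>: "l < \<mu>" "\<mu> < u" and \<nu>: "l < \<nu>" "\<nu> < u" for r \<mu> \<nu>
  proof -
    have near: "\<forall>\<^sub>F s in at r. l < \<kappa> * \<tau> r / \<tau> s \<and> \<kappa> * \<tau> r / \<tau> s < u" if "l < \<kappa>" "\<kappa> < u" for \<kappa>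
    proof -
      have "((\<lambda>s. \<kappa> * \<tau> r / \<tau> s) \<longlongrightarrow> \<kappa> * \<tau> r / \<tau> r) (at r)"
        using pos[OF r] by (intro tendsto_intros lim r) simp
      then have "((\<lambda>s. \<kappa> * \<tau> r / \<tau> s) \<longlongrightarrow> \<kappa>) (at r)" using pos[OF r] by simp
      from order_tendstoD[OF this] that show ?thesis by (auto intro: eventually_conj)
    qed
    have "\<forall>\<^sub>F s in at r. s \<noteq> r" by (simp add: eventually_at_filter)
    with near[OF \<mu>] near[OF \<nu>] ev_pos[OF r]
    have "\<forall>\<^sub>F s in at r. (l < \<mu> * \<tau> r / \<tau> s \<and> \<mu> * \<tau> r / \<tau> s < u) \<and>
        (l < \<nu> * \<tau> r / \<tau> s \<and> \<nu> * \<tau> r / \<tau> s < u) \<and> 0 < s \<and> s \<noteq> r"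
      by eventually_elim auto
    then obtain s where s: "0 < s" "s \<noteq> r" and \<mu>s: "l < \<mu> * \<tau> r / \<tau> s" "\<mu> * \<tau> r / \<tau> s < u"
      and \<nu>s: "l < \<nu> * \<tau> r / \<tau> s" "\<nu> * \<tau> r / \<tau> s < u"
      using eventually_happens[of _ "at r"] by auto
    have ne: "\<tau> s \<noteq> \<tau> r" using mono[of r s] mono[of s r] s r by linarith
    have canc: "\<kappa> * \<tau> r / \<tau> s * \<tau> s = \<kappa> * \<tau> r" for \<kappa> using pos[OF s(1)] by simp
    let ?y = "C + \<mu> * \<tau> r" and ?z = "C + \<nu> * \<tau> r"
    have 1: "a * (\<mu> * \<tau> r) + b * \<tau> r + c = q r * h ?y" "a * (\<nu> * \<tau> r) + b * \<tau> r + c = q r * h ?z"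
      using eq[OF r] \<mu> \<nu> by auto
    have 2: "a * (\<mu> * \<tau> r) + b * \<tau> s + c = q s * h ?y" "a * (\<nu> * \<tau> r) + b * \<tau> s + c = q s * h ?z"
      using eq[OF s(1), of "\<mu> * \<tau> r / \<tau> s"] eq[OF s(1), of "\<nu> * \<tau> r / \<tau> s"] \<mu>s \<nu>s
      unfolding canc by auto
    have "b * (\<tau> s - \<tau> r) * (h ?y - h ?z) = 0"
      using 1 2 by algebra
    then show ?thesis using b ne by simp
  qed
  \<comment> \<open>The midpoint represents the open interval of each radius and stays inside those of nearby radii.\<close>
  define m where "m = (l + u) / 2"
  have m: "l < m" "m < u" using lu by (simp_all add: m_def)
  have mid: "h (C + m * \<tau> r) = h (C + m * \<tau> 1)" if "0 < r" for r
  proof (rule connected_local_const[of "{0<..}" r 1 "\<lambda>r. h (C + m * \<tau> r)"])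
    show "\<forall>r\<in>{0<..}. \<forall>\<^sub>F s in at r within {0<..}. h (C + m * \<tau> r) = h (C + m * \<tau> s)"
    proof
      fix r :: real assume "r \<in> {0<..}"
      then have r: "0 < r" by simp
      have "((\<lambda>s. m * \<tau> s / \<tau> r) \<longlongrightarrow> m * \<tau> r / \<tau> r) (at r)"
        using pos[OF r] by (intro tendsto_intros lim r) simp
      then have "((\<lambda>s. m * \<tau> s / \<tau> r) \<longlongrightarrow> m) (at r)" using pos[OF r] by simp
      from order_tendstoD[OF this] m
      have "\<forall>\<^sub>F s in at r. l < m * \<tau> s / \<tau> r \<and> m * \<tau> s / \<tau> r < u" by (auto intro: eventually_conj)
      then show "\<forall>\<^sub>F s in at r within {0<..}. h (C + m * \<tau> r) = h (C + m * \<tau> s)"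
        unfolding at_within[OF r]
      proof (rule eventually_mono)
        fix s assume "l < m * \<tau> s / \<tau> r \<and> m * \<tau> s / \<tau> r < u"
        then show "h (C + m * \<tau> r) = h (C + m * \<tau> s)"
          using inner[OF r m, of "m * \<tau> s / \<tau> r"] pos[OF r] by simp
      qed
    qed
  qed (use that in auto)
  have "h (C + \<mu> * \<tau> r) = h (C + m * \<tau> 1)" if r: "0 < r" and \<mu>: "\<mu> \<in> {l..u}" for r \<mu>
  proof (rule continuous_constant_on_closure[of "{l<..<u}" "\<lambda>\<mu>. h (C + \<mu> * \<tau> r)"])
    show "continuous_on (closure {l<..<u}) (\<lambda>\<mu>. h (C + \<mu> * \<tau> r))"
    proof (intro continuous_at_imp_continuous_on ballI)
      fix \<kappa> assume "\<kappa> \<in> closure {l<..<u}"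
      then have "l \<le> \<kappa>" "\<kappa> \<le> u" using lu by auto
      then show "isCont (\<lambda>\<mu>. h (C + \<mu> * \<tau> r)) \<kappa>"
        by (intro continuous_at_compose[of _ "\<lambda>\<mu>. C + \<mu> * \<tau> r" h, unfolded o_def] continuous_intros cont_h r)
    qed
    show "h (C + \<kappa> * \<tau> r) = h (C + m * \<tau> 1)" if "\<kappa> \<in> {l<..<u}" for \<kappa>
      using inner[OF r m, of \<kappa>] mid[OF r] that by simp
  qed (use \<mu> lu in auto)
  then show ?thesis by blast
qed

context radial_kaehler_metric
begin

text \<open>
  Here \<open>\<sigma>\<close> is \<open>P(s)\<close> as a function of \<open>x \<bullet> x\<close>, available because the scalar curvature is radial. The unit sphere
  gives \<open>B = a A + b Id\<close>; then the equation on all spheres together is the separated affine relation in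
  \<open>\<mu> = \<langle>Ae,e\<rangle>\<close> and \<open>r\<close>, where \<open>x = r e\<close>.
\<close>

lemma separable_potentials_constant:
  assumes dim: "2 \<le> cdim TYPE('v)"
    and A: "self_adjoint A" "self_adjoint B" "linearly_independent_fields A B"
    and \<phi>1: "\<And>x. x \<noteq> 0 \<Longrightarrow> \<phi>1 x = F_of A x * f (x \<bullet> x) / 2 + C1"
    and \<phi>2: "\<And>x. x \<noteq> 0 \<Longrightarrow> \<phi>2 x = F_of B x * f (x \<bullet> x) / 2 + C2"
    and h: "\<And>x. x \<noteq> 0 \<Longrightarrow> h differentiable (at (\<phi>1 x))"
    and eq: "\<And>x. x \<noteq> 0 \<Longrightarrow> \<phi>2 x = P (scalar_curvature g x) * h (\<phi>1 x)"
  shows "h constant_on \<phi>1 ` (- {0})"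
proof -
  define \<sigma> where "\<sigma> t = P (real DIM('v) * ric1_op t + 2 * t * ric2_op t)" for t
  have eq': "\<phi>2 x = \<sigma> (x \<bullet> x) * h (\<phi>1 x)" if "x \<noteq> 0" for x
    using eq[OF that] scalar_curvature_eq[OF that] by (simp add: \<sigma>_def)
  note linA = self_adjoint_linear[OF A(1)] and symA = self_adjoint_inner[OF A(1)]
    and linB = self_adjoint_linear[OF A(2)] and symB = self_adjoint_inner[OF A(2)]
  have F: "F_of L x = L x \<bullet> x" for L :: "'v \<Rightarrow> 'v" and x
    by (simp add: F_of_def Re_hip)
  have f1: "0 < f 1" by (rule f_pos) simp
  \<comment> \<open>On the unit sphere the equation, solved for the quadratic form of \<open>B\<close>, has the right-hand side \<open>\<psi>\<close>.\<close>
  define \<psi> where "\<psi> y = 2 / f 1 * (\<sigma> 1 * h (y * f 1 / 2 + C1) - C2)" for y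
  have unit: "x \<noteq> 0" "x \<bullet> x = 1" if "norm x = 1" for x :: 'v
    using that by (auto simp: norm_eq_1)
  have dep: "B x \<bullet> x = \<psi> (A x \<bullet> x)" if "norm x = 1" for x
    using eq'[of x] \<phi>1[of x] \<phi>2[of x] unit[OF that] f1 by (simp add: \<psi>_def F field_simps)
  have diff: "\<psi> differentiable (at (A x \<bullet> x))" if "norm x = 1" for x
  proof -
    have "h differentiable (at (A x \<bullet> x * f 1 / 2 + C1))"
      using h[of x] \<phi>1[of x] unit[OF that] by (simp add: F)
    then obtain D where "(h has_real_derivative D) (at (A x \<bullet> x * f 1 / 2 + C1))"
      by (auto simp: real_differentiable_def)
    then have "((\<lambda>y. h (y * f 1 / 2 + C1)) has_real_derivative D * (f 1 / 2)) (at (A x \<bullet> x))"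
      by (rule DERIV_chain2) (auto intro!: derivative_eq_intros)
    then show ?thesis
      unfolding \<psi>_def[abs_def]
      by (intro differentiable_mult differentiable_diff differentiable_const)
        (auto simp: real_differentiable_def)
  qed
  obtain a b l u where lu: "\<And>x. norm x = 1 \<Longrightarrow> l \<le> A x \<bullet> x \<and> A x \<bullet> x \<le> u"
    and range: "\<And>\<mu>. l \<le> \<mu> \<Longrightarrow> \<mu> \<le> u \<Longrightarrow> \<exists>x. norm x = 1 \<and> A x \<bullet> x = \<mu>"
    and B: "\<And>x. B x = a *\<^sub>R A x + b *\<^sub>R x"
  proof (rule quadratic_forms_dependent[OF linA symA linB symB dep diff])
    fix a b l u
    assume "\<And>x. norm x = 1 \<Longrightarrow> l \<le> A x \<bullet> x \<and> A x \<bullet> x \<le> u"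
      "\<And>\<mu>. l \<le> \<mu> \<Longrightarrow> \<mu> \<le> u \<Longrightarrow> \<exists>x. norm x = 1 \<and> A x \<bullet> x = \<mu>"
      "\<And>x. B x = a *\<^sub>R A x + b *\<^sub>R x"
    then show thesis by (rule that)
  qed
  have indep: "s = 0 \<and> t = 0" if "\<And>x. s *\<^sub>R A x + t *\<^sub>R B x = 0" for s t
    using A(3) that unfolding linearly_independent_fields_def by blast
  \<comment> \<open>Both degenerate cases contradict linear independence: \<open>b = 0\<close> means \<open>B = a A\<close>, and \<open>l = u\<close> makes \<open>A\<close>,
    and with it \<open>B\<close>, a multiple of the identity.\<close>
  have "b \<noteq> 0"
    using indep[of a "-1"] B by auto
  have "l < u"
  proof (rule ccontr)
    assume "\<not> l < u"
    then have Al: "A x \<bullet> x = l" if "norm x = 1" for x using lu[OF that] by linarith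
    have "A x - l *\<^sub>R x = 0" for x
    proof (rule symmetric_zero_if_quadratic_form_zero[of "\<lambda>x. A x - l *\<^sub>R x"])
      show "linear (\<lambda>x. A x - l *\<^sub>R x)"
        by (intro linear_compose_sub linear_compose_scale_right linA linear_id[unfolded id_def])
      show "(A x - l *\<^sub>R x) \<bullet> y = x \<bullet> (A y - l *\<^sub>R y)" for x y
        using symA[of x y] by (simp add: inner_diff_left inner_diff_right)
      show "(A x - l *\<^sub>R x) \<bullet> x = 0" if "norm x = 1" for x
        using Al[OF that] unit[OF that] by (simp add: inner_diff_left)
    qed
    then have "A x = l *\<^sub>R x" for x by simp
    then show False
      using indep[of "a * l + b" "- l"] indep[of "a" "-1"] indep[of 1 0] B \<open>b \<noteq> 0\<close>
      by (auto simp: algebra_simps)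
  qed
  \<comment> \<open>The potential \<open>\<tau>\<close> as a function of the radius; its derivative is \<open>r S(r)\<close>.\<close>
  define \<tau>r where "\<tau>r r = r\<^sup>2 * f (r\<^sup>2) / 2" for r :: real
  have radius: "\<exists>x::'v. x \<noteq> 0 \<and> x \<bullet> x = r\<^sup>2" if "0 < r" for r :: real
    using vector_choose_size[of r] that by (metis dot_square_norm less_imp_le norm_zero less_irrefl)
  have DERIV_\<tau>r: "(\<tau>r has_real_derivative r * (f (r\<^sup>2) + r\<^sup>2 * f1 (r\<^sup>2))) (at r)" if "0 < r" for r
  proof -
    have "((\<lambda>r. f (r\<^sup>2)) has_real_derivative f1 (r\<^sup>2) * (2 * r)) (at r)"
      using that by (intro DERIV_chain2[OF DERIV_f]) (auto intro!: derivative_eq_intros)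
    then show ?thesis
      unfolding \<tau>r_def[abs_def]
      by (auto intro!: derivative_eq_intros simp: algebra_simps power2_eq_square)
  qed
  have "\<exists>K. \<forall>r>0. \<forall>\<mu>\<in>{l..u}. h (C1 + \<mu> * \<tau>r r) = K"
  proof (rule separated_affine_function_constant[OF _ _ _ \<open>l < u\<close> \<open>b \<noteq> 0\<close>])
    show "continuous_on {0<..} \<tau>r"
      using DERIV_\<tau>r by (intro continuous_at_imp_continuous_on) (auto intro: DERIV_isCont)
    show "0 < \<tau>r r" if "0 < r" for r
      using that f_pos[of "r\<^sup>2"] by (simp add: \<tau>r_def)
    show "\<tau>r r < \<tau>r s" if "0 < r" "r < s" for r s
    proof (rule DERIV_pos_imp_increasing[OF that(2)])
      fix y assume "r \<le> y" "y \<le> s"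
      then have y: "0 < y" using that by simp
      obtain x :: 'v where "x \<noteq> 0" "x \<bullet> x = y\<^sup>2" using radius[OF y] by blast
      then have "0 < f (y\<^sup>2) + y\<^sup>2 * f1 (y\<^sup>2)" using f_plus_pos[of x] by simp
      then show "\<exists>D. (\<tau>r has_real_derivative D) (at y) \<and> 0 < D"
        using y by (intro exI[of _ "y * (f (y\<^sup>2) + y\<^sup>2 * f1 (y\<^sup>2))"] conjI DERIV_\<tau>r) simp_all
    qed
    have at: "\<exists>x. x \<noteq> 0 \<and> x \<bullet> x = r\<^sup>2 \<and> \<phi>1 x = C1 + \<mu> * \<tau>r r \<and> \<phi>2 x = (a * \<mu> + b) * \<tau>r r + C2"
      if r: "0 < r" and \<mu>: "l \<le> \<mu>" "\<mu> \<le> u" for r \<mu>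
    proof -
      obtain e where e: "norm e = 1" "A e \<bullet> e = \<mu>" using range[OF \<mu>] by blast
      let ?x = "r *\<^sub>R e"
      have x: "?x \<noteq> 0" "?x \<bullet> ?x = r\<^sup>2"
        using e(1) r unit[OF e(1)] by (auto simp: power2_eq_square)
      have "A ?x \<bullet> ?x = \<mu> * r\<^sup>2"
        using e(2) by (simp add: linear_scale[OF linA] power2_eq_square)
      moreover from this have "B ?x \<bullet> ?x = (a * \<mu> + b) * r\<^sup>2"
        using x(2) unfolding B by (simp add: inner_add_left algebra_simps)
      ultimately show ?thesis
        using x \<phi>1[OF x(1)] \<phi>2[OF x(1)] by (intro exI[of _ ?x]) (simp add: F \<tau>r_def)
    qed
    show "a * (\<mu> * \<tau>r r) + b * \<tau>r r + C2 = \<sigma> (r\<^sup>2) * h (C1 + \<mu> * \<tau>r r)"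
      if "0 < r" "l \<le> \<mu>" "\<mu> \<le> u" for r \<mu>
      using at[OF that] eq' by (auto simp: algebra_simps)
    show "isCont h (C1 + \<mu> * \<tau>r r)" if "0 < r" "l \<le> \<mu>" "\<mu> \<le> u" for r \<mu>
      using at[OF that] h by (metis differentiable_imp_continuous_within)
  qed
  then obtain K where K: "\<And>r \<mu>. 0 < r \<Longrightarrow> \<mu> \<in> {l..u} \<Longrightarrow> h (C1 + \<mu> * \<tau>r r) = K" by blast
  have "h (\<phi>1 x) = K" if "x \<noteq> 0" for x
  proof -
    define e where "e = x /\<^sub>R norm x"
    have e: "norm e = 1" and x: "x = norm x *\<^sub>R e" using that by (simp_all add: e_def)
    have "A x = norm x *\<^sub>R A e" by (subst x) (simp add: linear_scale[OF linA])
    then have "A x \<bullet> x = (norm x)\<^sup>2 * (A e \<bullet> e)"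
      by (subst (2) x) (simp add: power2_eq_square)
    then have "\<phi>1 x = C1 + (A e \<bullet> e) * \<tau>r (norm x)"
      using \<phi>1[OF that] by (simp add: F \<tau>r_def dot_square_norm)
    then show ?thesis using K[of "norm x" "A e \<bullet> e"] lu[OF e] that by simp
  qed
  then show ?thesis unfolding constant_on_def by blast
qed

end

section \<open>The four characterisations and the separation property\<close>

text \<open>
  Decompose both arguments into the projection onto the complex line of \<open>x\<close> and the rest.
\<close>

lemma VH_form_metric_eq:
  fixes g :: "'v::hermitian_vector_space metric_tensor"
  assumes g: "riemannian_metric_on (- {0}) g" "has_VH_form g S T" and x: "x \<noteq> 0"
  shows "g x u v = T (norm x) * Re (hip u v) + (S (norm x) - T (norm x)) / (x \<bullet> x) * Re (hip u x * hip x v)"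
proof -
  define c where "c w = hip w x / of_real (x \<bullet> x)" for w
  define H where "H w = w - c w *\<^sub>C x" for w
  have V: "c w *\<^sub>C x \<in> vertical x" for w unfolding vertical_def by (rule rangeI)
  have Hx: "hip (H w) x = 0" for w
    using x by (simp add: H_def c_def hip_diff_left hip_scaleC_left hip_self)
  then have H: "H w \<in> horizontal x" for w
    by (auto simp: horizontal_def vertical_def hip_scaleC_right)
  have w: "w = c w *\<^sub>C x + H w" for w by (simp add: H_def)
  have bil: "bilinear (g x)" and sym: "\<And>u v. g x u v = g x v u"
    using g(1) x by (auto simp: riemannian_metric_on_def)
  have xH: "hip x (H w) = 0" for w using Hx[of w] cnj_hip[of "H w" x] by simp
  have t: "x \<bullet> x \<noteq> 0" using x by simp
  have cv: "hip (c u *\<^sub>C x) (c v *\<^sub>C x) = hip u x * hip x v / of_real (x \<bullet> x)"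
    using x by (simp add: c_def hip_scaleC_left hip_scaleC_right hip_self)
  have uv: "hip u v = hip (c u *\<^sub>C x) (c v *\<^sub>C x) + hip (H u) (H v)"
    by (subst (1) w[of u], subst (1) w[of v])
      (simp add: hip_add_left hip_add_right hip_scaleC_left hip_scaleC_right Hx xH)
  have VH: "g x (c u *\<^sub>C x) (H v) = 0" for u v
    using g(2) x V H by (simp add: has_VH_form_def)
  then have HV: "g x (H u) (c v *\<^sub>C x) = 0" for u v
    by (subst sym)
  have "g x u v = g x (c u *\<^sub>C x) (c v *\<^sub>C x) + g x (H u) (H v)"
  proof -
    have "g x (c u *\<^sub>C x + H u) (c v *\<^sub>C x + H v) = g x (c u *\<^sub>C x) (c v *\<^sub>C x) + g x (H u) (H v)"
      by (simp add: bilinear_ladd[OF bil] bilinear_radd[OF bil] VH HV)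
    then show ?thesis using w by metis
  qed
  also have "\<dots> = S (norm x) * Re (hip (c u *\<^sub>C x) (c v *\<^sub>C x)) + T (norm x) * Re (hip (H u) (H v))"
    using g(2) x V H by (simp add: has_VH_form_def)
  also have "\<dots> = T (norm x) * Re (hip u v) + (S (norm x) - T (norm x)) * Re (hip (c u *\<^sub>C x) (c v *\<^sub>C x))"
    unfolding uv by (simp add: algebra_simps)
  also have "Re (hip (c u *\<^sub>C x) (c v *\<^sub>C x)) = Re (hip u x * hip x v) / (x \<bullet> x)"
    unfolding cv by (rule Re_divide_of_real)
  finally show ?thesis by simp
qed

text \<open>
  The transition from functions of \<open>r\<close> to functions of \<open>t = r\<^sup>2\<close>.
\<close>

lemma DERIV_comp_sqrt:
  assumes "(h has_real_derivative h') (at (sqrt t))" "0 < t"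
  shows "((\<lambda>t. h (sqrt t)) has_real_derivative h' / (2 * sqrt t)) (at t)"
proof -
  have "(sqrt has_real_derivative inverse (sqrt t) / 2) (at t)"
    using assms(2) by (rule DERIV_real_sqrt)
  from DERIV_chain2[OF assms(1) this] show ?thesis by (simp add: field_simps)
qed

theorem theorem3p1:
  fixes g :: "'v::hermitian_vector_space \<Rightarrow> 'v \<Rightarrow> 'v \<Rightarrow> real"
    and S T :: "real \<Rightarrow> real"
  assumes dim: "2 \<le> cdim TYPE('v)"
    and S: "smooth_on {0<..} S" "\<And>r. 0 < r \<Longrightarrow> 0 < S r"
    and T: "smooth_on {0<..} T" "\<And>r. 0 < r \<Longrightarrow> 0 < T r"
    and g: "riemannian_metric_on (- {0}) g" "has_VH_form g S T"
  shows "let a = kaehler_metric_on (- {0}) g;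
             b = SKR_metric_on (- {0}) g;
             c = (\<forall>r>0. S r = T r + r / 2 * deriv T r);
             d = potentials_given_by g T
    in ((a \<longleftrightarrow> b) \<and> (b \<longleftrightarrow> c) \<and> (c \<longleftrightarrow> d)) \<and>
       (3 \<le> cdim TYPE('v) \<and> (a \<or> b \<or> c \<or> d) \<longrightarrow>
         (\<forall>A1 A2 \<phi>1 \<phi>2 p h P Q.
            self_adjoint A1 \<and> self_adjoint A2 \<and> linearly_independent_fields A1 A2 \<and>
            holomorphy_potential_on (- {0}) g A1 \<phi>1 \<and> holomorphy_potential_on (- {0}) g A2 \<phi>2 \<and>
            open P \<and> scalar_curvature g ` (- {0}) \<subseteq> P \<and> smooth_on P p \<and>
            open Q \<and> \<phi>1 ` (- {0}) \<subseteq> Q \<and> smooth_on Q h \<and>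
            (\<forall>x. x \<noteq> 0 \<longrightarrow> \<phi>2 x = p (scalar_curvature g x) * h (\<phi>1 x))
            \<longrightarrow> h constant_on \<phi>1 ` (- {0})))"
proof -
  define T1 where "T1 = deriv T"
  define T2 where "T2 = deriv T1"
  have open_pos: "open {0::real<..}" by simp
  have T': "(T has_real_derivative T1 r) (at r)"
    and T1': "(T1 has_real_derivative T2 r) (at r)"
    and T2': "(T2 has_real_derivative deriv T2 r) (at r)"
    and S': "(S has_real_derivative deriv S r) (at r)" if "0 < r" for r
  proof -
    have s1: "smooth_on {0<..} T1" unfolding T1_def by (rule smooth_on_deriv(1)[OF open_pos T(1)])
    have s2: "smooth_on {0<..} T2" unfolding T2_def by (rule smooth_on_deriv(1)[OF open_pos s1])
    have r: "r \<in> {0<..}" using that by simp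
    show "(T has_real_derivative T1 r) (at r)"
      unfolding T1_def by (rule smooth_on_deriv(2)[OF open_pos T(1) r])
    show "(T1 has_real_derivative T2 r) (at r)"
      unfolding T2_def by (rule smooth_on_deriv(2)[OF open_pos s1 r])
    show "(T2 has_real_derivative deriv T2 r) (at r)"
      by (rule smooth_on_deriv(2)[OF open_pos s2 r])
    show "(S has_real_derivative deriv S r) (at r)"
      by (rule smooth_on_deriv(2)[OF open_pos S(1) r])
  qed
  \<comment> \<open>\<open>f1\<close> and \<open>f2\<close> are the first two derivatives of \<open>f\<close>, in the form in which the chain and quotient
    rules produce them.\<close>
  define f f1 f2 k where "f t = T (sqrt t)" and "f1 t = T1 (sqrt t) / (2 * sqrt t)"
    and "f2 t = (T2 (sqrt t) / (2 * sqrt t) * (2 * sqrt t) - T1 (sqrt t) * (inverse (sqrt t))) / (2 * sqrt t * (2 * sqrt t))"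
    and "k t = (S (sqrt t) - T (sqrt t)) / t" for t
  have sq: "((\<lambda>t. 2 * sqrt t) has_real_derivative inverse (sqrt t)) (at t)" if "0 < t" for t
    using DERIV_cmult[OF DERIV_real_sqrt[OF that], of 2] by simp
  have f: "(f has_real_derivative f1 t) (at t)" if "0 < t" for t
    unfolding f_def[abs_def] f1_def using that by (intro DERIV_comp_sqrt T') simp
  have f1: "(f1 has_real_derivative f2 t) (at t)" if "0 < t" for t
    unfolding f1_def[abs_def] f2_def
    using that by (intro DERIV_divide DERIV_comp_sqrt T1' sq) simp_all
  have f2: "f2 differentiable (at t)" if "0 < t" for t
  proof -
    have "(\<lambda>t. T1 (sqrt t)) differentiable (at t)" "(\<lambda>t. T2 (sqrt t)) differentiable (at t)"
      "sqrt differentiable (at t)"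
      using DERIV_comp_sqrt[OF T1' that] DERIV_comp_sqrt[OF T2' that] DERIV_real_sqrt[OF that] that
      by (auto simp: real_differentiable_def)
    then show ?thesis
      unfolding f2_def[abs_def] using that
      by (intro differentiable_divide differentiable_diff differentiable_mult differentiable_const differentiable_inverse) simp_all
  qed
  have k: "(k has_real_derivative deriv k t) (at t)" if "0 < t" for t
  proof -
    have "(\<lambda>t. T (sqrt t)) differentiable (at t)" "(\<lambda>t. S (sqrt t)) differentiable (at t)"
      using DERIV_comp_sqrt[OF T' that] DERIV_comp_sqrt[OF S' that] that
      by (auto simp: real_differentiable_def)
    then have "k differentiable (at t)"
      unfolding k_def[abs_def] using that
      by (intro differentiable_divide differentiable_diff differentiable_ident) simp_all
    then show ?thesis by (simp add: DERIV_deriv_iff_real_differentiable)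
  qed
  have metric: "g x u v = f (x \<bullet> x) * Re (hip u v) + k (x \<bullet> x) * Re (hip u x * hip x v)" if "x \<noteq> 0" for x u v
    using VH_form_metric_eq[OF g that] by (simp add: f_def k_def norm_eq_sqrt_inner)
  interpret radial_hermitian_metric g f f1 k
    by unfold_locales (use g metric f k T(2) in \<open>auto simp: f_def\<close>)
  have ode: "(\<forall>r>0. S r = T r + r / 2 * deriv T r) \<longleftrightarrow> (\<forall>t>0. k t = f1 t)"
  proof (intro iffI allI impI)
    fix t :: real assume c: "\<forall>r>0. S r = T r + r / 2 * deriv T r" and t: "0 < t"
    define r where "r = sqrt t"
    have r: "0 < r" "t = r\<^sup>2" using t by (simp_all add: r_def)
    have d: "S r - T r = r / 2 * T1 r" using c r(1) by (simp add: T1_def)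
    have "k t = (S r - T r) / r\<^sup>2"
      using r(1) unfolding r(2) by (simp add: k_def)
    also have "\<dots> = (r / 2 * T1 r) / r\<^sup>2" unfolding d ..
    also have "\<dots> = f1 t"
      using r(1) unfolding r(2) by (simp add: f1_def power2_eq_square)
    finally show "k t = f1 t" .
  next
    fix r :: real assume c: "\<forall>t>0. k t = f1 t" and r: "0 < r"
    have "(S r - T r) / r\<^sup>2 = T1 r / (2 * r)"
      using c[rule_format, of "r\<^sup>2"] r by (simp add: k_def f1_def)
    then show "S r = T r + r / 2 * deriv T r"
      using r by (simp add: T1_def divide_simps power2_eq_square mult.commute)
  qed
  have a: "kaehler_metric_on (- {0}) g \<longleftrightarrow> (\<forall>t>0. k t = f1 t)"
    by (rule kaehler_iff[OF dim])
  have d: "potentials_given_by g T \<longleftrightarrow> (\<forall>t>0. k t = f1 t)"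
    by (rule potentials_given_by_iff[OF dim]) (simp add: f_def)
  have kaehler: "radial_kaehler_metric g f f1 f2" if "\<forall>t>0. k t = f1 t"
  proof unfold_locales
    show "(f1 has_real_derivative deriv f1 t) (at t)" if "0 < t" for t
      using f1[OF that] by (metis DERIV_imp_deriv)
  qed (use g metric f f1 f2 T(2) that in \<open>auto simp: f_def\<close>)
  have b: "SKR_metric_on (- {0}) g \<longleftrightarrow> (\<forall>t>0. k t = f1 t)"
    using a radial_kaehler_metric.SKR_metric[OF kaehler dim] unfolding SKR_metric_on_def by blast
  have 2: "h constant_on \<phi>1 ` (- {0})"
    if K: "\<forall>t>0. k t = f1 t" and A: "self_adjoint A1" "self_adjoint A2" "linearly_independent_fields A1 A2"
      and \<phi>: "holomorphy_potential_on (- {0}) g A1 \<phi>1" "holomorphy_potential_on (- {0}) g A2 \<phi>2"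
      and h: "\<phi>1 ` (- {0}) \<subseteq> Q" "smooth_on Q h"
      and eq: "\<forall>x. x \<noteq> 0 \<longrightarrow> \<phi>2 x = p (scalar_curvature g x) * h (\<phi>1 x)"
    for A1 A2 \<phi>1 \<phi>2 p h Q
  proof -
    have pot: "\<exists>C. \<forall>x. x \<noteq> 0 \<longrightarrow> \<phi> x = F_of A x * f (x \<bullet> x) / 2 + C"
      if "self_adjoint A" "holomorphy_potential_on (- {0}) g A \<phi>" for A \<phi>
      using d K that by (simp add: potentials_given_by_def f_def norm_eq_sqrt_inner)
    obtain C1 where C1: "\<And>x. x \<noteq> 0 \<Longrightarrow> \<phi>1 x = F_of A1 x * f (x \<bullet> x) / 2 + C1"
      using pot[OF A(1) \<phi>(1)] by blast
    obtain C2 where C2: "\<And>x. x \<noteq> 0 \<Longrightarrow> \<phi>2 x = F_of A2 x * f (x \<bullet> x) / 2 + C2"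
      using pot[OF A(2) \<phi>(2)] by blast
    have h': "h differentiable (at (\<phi>1 x))" if "x \<noteq> 0" for x
      using smooth_on_imp_differentiable[OF h(2)] h(1) that by auto
    show ?thesis
      by (rule radial_kaehler_metric.separable_potentials_constant[OF kaehler[OF K] dim A C1 C2 h'])
        (use eq in auto)
  qed
  show ?thesis
    unfolding Let_def a b d ode using 2 by blast
qed

end
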